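(* Fix $x\in H^{n+1}$. For $t\in\mathbb{R}$ and $f=\sum_{g\in\Gamma}f_g\,g\in C^*_r(\Gamma,\Lambda)$ put $$(\alpha_t f)_g(\xi)=e^{\,it\,D(x,\,xg^{-1},\,\xi)}\,f_g(\xi)\qquad (g\in\Gamma,\ \xi\in\Lambda).$$ Then $\alpha=(\alpha_t)_{t\in\mathbb{R}}$ is a strongly continuous one-parameter group of $*$-automorphisms of $C^*_r(\Gamma,\Lambda)$.
   Context: $\Gamma$ is a torsion-free nonelementary (not virtually abelian) discrete subgroup of $\mathrm{Isom}^+(H^{n+1})$, the orientation-preserving isometries of hyperbolic space, acting on the right on $H^{n+1}$ and on the sphere at infinity $S^n$. $\Lambda\subset S^n$ is its limit set (the minimal nonempty closed $\Gamma$-invariant subset). $\Gamma$ acts on $C(\Lambda)$ by $(g\cdot f)(\xi)=f(\xi g)$. For $x,x'\in H^{n+1}$ and $\xi\in\Lambda$, $D(x,x',\xi)=\lim_{x''\to\xi}\bigl(d(x,x'')-d(x',x'')\bigr)$, where $d$ is hyperbolic distance and $x''\in H^{n+1}$. The algebraic cross-product $C(\Lambda)\rtimes\Gamma$ consists of finite formal sums $f=\sum_g f_g\,g$ with $f_g\in C(\Lambda)$, with product $(ff')_\gamma(\xi)=\sum_{gg'=\gamma}f_g(\xi)f'_{g'}(\xi g)$ and involution $(f^* )_g(\xi)=\overline{f_{g^{-1}}(\xi g)}$. For $\xi\in\Lambda$, $\pi^\xi$ is the $*$-representation on $l^2(\Gamma)$ given by $(\pi^\xi(f)c)_\gamma=\sum_{\gamma'\in\Gamma}f_{\gamma(\gamma')^{-1}}(\xi\gamma^{-1})\,c_{\gamma'}$.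 The reduced cross-product $C^*$-algebra $C^*_r(\Gamma,\Lambda)$ is the completion of $C(\Lambda)\rtimes\Gamma$ in the norm $\sup_{\xi\in\Lambda}\|\pi^\xi(f)\|$. Each element of $C^*_r(\Gamma,\Lambda)$ is determined by its coefficients $f_g\in C(\Lambda)$, i.e. by a (possibly infinite) formal sum $\sum_g f_g\,g$, acting in $\pi^\xi$ by the same matrix formula. *)

theory Defs
  imports "HOL-Analysis.Analysis" "HOL-Algebra.Coset"
begin

section \<open>Hyperbolic space\<close>

text \<open>
  Hyperbolic space of dimension \<open>n + 1 = CARD('m)\<close> is the Poincare ball model: the open unit ball
  of \<open>real ^ 'm\<close>, with curvature \<open>-1\<close>. Its sphere at infinity is the unit sphere, and
  convergence of interior points to a point at infinity is convergence in the closed ball.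
\<close>

type_synonym 'm point = "real ^ 'm"

type_synonym 'm isom = "'m point \<Rightarrow> 'm point"

abbreviation hyp_space :: "('m::finite) point set" where
  "hyp_space \<equiv> ball 0 1"

abbreviation sphere_at_infinity :: "('m::finite) point set" where
  "sphere_at_infinity \<equiv> sphere 0 1"

definition hyp_dist :: "('m::finite) point \<Rightarrow> 'm point \<Rightarrow> real" where
  "hyp_dist x y = arcosh (1 + 2 * (norm (x - y))\<^sup>2 / ((1 - (norm x)\<^sup>2) * (1 - (norm y)\<^sup>2)))"

definition orientation_preserving :: "('m::finite) isom \<Rightarrow> bool" where
  "orientation_preserving g \<longleftrightarrow>
     (\<forall>x\<in>hyp_space. \<exists>g'. (g has_derivative g') (at x) \<and> det (matrix g') > 0)"

text \<open>
  The group acts on the right: \<open>x g\<close> is written \<open>g x\<close>, so the product of \<open>g\<close> and \<open>h\<close> is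
  ``first \<open>g\<close>, then \<open>h\<close>''. Isometries are extensional functions on the ball, so that equality
  of isometries is equality of functions.
\<close>

definition isom_plus :: "('m::finite) isom monoid" where
  "isom_plus =
     \<lparr>carrier = {g \<in> extensional hyp_space. bij_betw g hyp_space hyp_space \<and>
        (\<forall>x\<in>hyp_space. \<forall>y\<in>hyp_space. hyp_dist (g x) (g y) = hyp_dist x y) \<and>
        orientation_preserving g},
      mult = (\<lambda>g h. compose hyp_space h g),
      one = (\<lambda>x\<in>hyp_space. x)\<rparr>"

text \<open>The compact-open topology.\<close>

definition isom_topology :: "('m::finite) isom topology" where
  "isom_topology = topology_generated_by
     {{g \<in> carrier isom_plus. g ` K \<subseteq> U} | K U. compact K \<and> K \<subseteq> hyp_space \<and> open U}"

definition discrete_subgroup :: "('m::finite) isom set \<Rightarrow> bool" where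
  "discrete_subgroup \<Gamma> \<longleftrightarrow>
     subgroup \<Gamma> isom_plus \<and> subtopology isom_topology \<Gamma> = discrete_topology \<Gamma>"

definition torsion_free :: "('m::finite) isom set \<Rightarrow> bool" where
  "torsion_free \<Gamma> \<longleftrightarrow>
     (\<forall>g\<in>\<Gamma>. \<forall>k::nat. k > 0 \<and> g [^]\<^bsub>isom_plus\<^esub> k = \<one>\<^bsub>isom_plus\<^esub> \<longrightarrow> g = \<one>\<^bsub>isom_plus\<^esub>)"

definition virtually_abelian :: "('m::finite) isom set \<Rightarrow> bool" where
  "virtually_abelian \<Gamma> \<longleftrightarrow>
     (\<exists>A. subgroup A (isom_plus\<lparr>carrier := \<Gamma>\<rparr>) \<and>
          (\<forall>a\<in>A. \<forall>b\<in>A. a \<otimes>\<^bsub>isom_plus\<^esub> b = b \<otimes>\<^bsub>isom_plus\<^esub> a) \<and>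
          finite (rcosets\<^bsub>isom_plus\<lparr>carrier := \<Gamma>\<rparr>\<^esub> A))"

definition nonelementary :: "('m::finite) isom set \<Rightarrow> bool" where
  "nonelementary \<Gamma> \<longleftrightarrow> \<not> virtually_abelian \<Gamma>"


section \<open>Action at infinity, limit set, Busemann function\<close>

text \<open>The action on the sphere at infinity is the continuous extension of the one on the ball.\<close>

definition bdry :: "('m::finite) isom \<Rightarrow> 'm point \<Rightarrow> 'm point" where
  "bdry g \<xi> = Lim (at \<xi> within hyp_space) g"

definition limit_set :: "('m::finite) isom set \<Rightarrow> 'm point set" where
  "limit_set \<Gamma> = {\<xi> \<in> sphere_at_infinity.
     \<forall>A. A \<subseteq> sphere_at_infinity \<and> A \<noteq> {} \<and> closed A \<and> (\<forall>g\<in>\<Gamma>. bdry g ` A \<subseteq> A) \<longrightarrow> \<xi> \<in> A}"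

definition busemann :: "('m::finite) point \<Rightarrow> 'm point \<Rightarrow> 'm point \<Rightarrow> real" where
  "busemann x x' \<xi> = Lim (at \<xi> within hyp_space) (\<lambda>x''. hyp_dist x x'' - hyp_dist x' x'')"


section \<open>The Hilbert space of square-summable functions\<close>

definition l2 :: "'g set \<Rightarrow> ('g \<Rightarrow> complex) set" where
  "l2 \<Gamma> = {c. (\<forall>\<gamma>. \<gamma> \<notin> \<Gamma> \<longrightarrow> c \<gamma> = 0) \<and> (\<lambda>\<gamma>. (cmod (c \<gamma>))\<^sup>2) summable_on \<Gamma>}"

definition l2_norm :: "'g set \<Rightarrow> ('g \<Rightarrow> complex) \<Rightarrow> ennreal" where
  "l2_norm \<Gamma> c =
     (if (\<lambda>\<gamma>. (cmod (c \<gamma>))\<^sup>2) summable_on \<Gamma>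
      then ennreal (sqrt (\<Sum>\<^sub>\<infinity>\<gamma>\<in>\<Gamma>. (cmod (c \<gamma>))\<^sup>2)) else \<infinity>)"

definition op_norm :: "'g set \<Rightarrow> (('g \<Rightarrow> complex) \<Rightarrow> ('g \<Rightarrow> complex)) \<Rightarrow> ennreal" where
  "op_norm \<Gamma> T = (SUP c\<in>{c \<in> l2 \<Gamma>. l2_norm \<Gamma> c \<le> 1}. l2_norm \<Gamma> (T c))"


section \<open>The reduced cross-product\<close>

text \<open>
  A formal sum \<open>\<Sum>g. f\<^sub>g g\<close>, finite or infinite, is the function \<open>f\<close> with \<open>f g \<xi> = f\<^sub>g(\<xi>)\<close>, set to
  \<open>0\<close> unless \<open>g \<in> \<Gamma>\<close> and \<open>\<xi> \<in> \<Lambda>\<close>.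
\<close>

type_synonym 'm formal_sum = "'m isom \<Rightarrow> 'm point \<Rightarrow> complex"

definition formal_sums :: "('m::finite) isom set \<Rightarrow> 'm point set \<Rightarrow> 'm formal_sum set" where
  "formal_sums \<Gamma> \<Lambda> =
     {f. (\<forall>g\<in>\<Gamma>. continuous_on \<Lambda> (f g)) \<and> (\<forall>g \<xi>. g \<notin> \<Gamma> \<or> \<xi> \<notin> \<Lambda> \<longrightarrow> f g \<xi> = 0)}"

definition alg_cross_product ::
    "('m::finite) isom set \<Rightarrow> 'm point set \<Rightarrow> 'm formal_sum set" where
  "alg_cross_product \<Gamma> \<Lambda> = {f \<in> formal_sums \<Gamma> \<Lambda>. finite {g \<in> \<Gamma>. \<exists>\<xi>\<in>\<Lambda>. f g \<xi> \<noteq> 0}}"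

definition cp_add :: "('m::finite) formal_sum \<Rightarrow> 'm formal_sum \<Rightarrow> 'm formal_sum" where
  "cp_add f f' = (\<lambda>g \<xi>. f g \<xi> + f' g \<xi>)"

definition cp_diff :: "('m::finite) formal_sum \<Rightarrow> 'm formal_sum \<Rightarrow> 'm formal_sum" where
  "cp_diff f f' = (\<lambda>g \<xi>. f g \<xi> - f' g \<xi>)"

definition cp_scale :: "complex \<Rightarrow> ('m::finite) formal_sum \<Rightarrow> 'm formal_sum" where
  "cp_scale z f = (\<lambda>g \<xi>. z * f g \<xi>)"

definition cp_mult ::
    "('m::finite) isom set \<Rightarrow> 'm formal_sum \<Rightarrow> 'm formal_sum \<Rightarrow> 'm formal_sum" where
  "cp_mult \<Gamma> f f' = (\<lambda>\<gamma> \<xi>.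
     \<Sum>\<^sub>\<infinity>(g, g') \<in> {(g, g'). g \<in> \<Gamma> \<and> g' \<in> \<Gamma> \<and> g \<otimes>\<^bsub>isom_plus\<^esub> g' = \<gamma>}. f g \<xi> * f' g' (bdry g \<xi>))"

definition cp_star ::
    "('m::finite) isom set \<Rightarrow> 'm point set \<Rightarrow> 'm formal_sum \<Rightarrow> 'm formal_sum" where
  "cp_star \<Gamma> \<Lambda> f = (\<lambda>g \<xi>.
     if g \<in> \<Gamma> \<and> \<xi> \<in> \<Lambda> then cnj (f (inv\<^bsub>isom_plus\<^esub> g) (bdry g \<xi>)) else 0)"

definition cp_rep ::
    "('m::finite) isom set \<Rightarrow> 'm point \<Rightarrow> 'm formal_sum \<Rightarrow> ('m isom \<Rightarrow> complex) \<Rightarrow> ('m isom \<Rightarrow> complex)" where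
  "cp_rep \<Gamma> \<xi> f c = (\<lambda>\<gamma>. if \<gamma> \<in> \<Gamma>
     then \<Sum>\<^sub>\<infinity>\<gamma>'\<in>\<Gamma>. f (\<gamma> \<otimes>\<^bsub>isom_plus\<^esub> inv\<^bsub>isom_plus\<^esub> \<gamma>') (bdry (inv\<^bsub>isom_plus\<^esub> \<gamma>) \<xi>) * c \<gamma>'
     else 0)"

definition cp_norm :: "('m::finite) isom set \<Rightarrow> 'm point set \<Rightarrow> 'm formal_sum \<Rightarrow> ennreal" where
  "cp_norm \<Gamma> \<Lambda> f = (SUP \<xi>\<in>\<Lambda>. op_norm \<Gamma> (cp_rep \<Gamma> \<xi> f))"

text \<open>
  Since \<open>|f\<^sub>g(\<xi>)|\<close> is bounded by the norm of \<open>f\<close>, the formal sums of finite norm form a Banach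
  space, so the completion of the algebraic cross-product is its norm closure among formal sums.
  A formal sum of finite norm has square-summable rows (test on finitely supported vectors), so
  the infinite sums in the representation are then absolutely convergent, and likewise the sums
  in the product of two elements of the completion.
\<close>

definition reduced_cross_product ::
    "('m::finite) isom set \<Rightarrow> 'm point set \<Rightarrow> 'm formal_sum set" where
  "reduced_cross_product \<Gamma> \<Lambda> = {f \<in> formal_sums \<Gamma> \<Lambda>.
     \<forall>\<epsilon>>0. \<exists>f'\<in>alg_cross_product \<Gamma> \<Lambda>. cp_norm \<Gamma> \<Lambda> (cp_diff f f') < \<epsilon>}"

definition star_automorphism ::
    "('m::finite) isom set \<Rightarrow> 'm point set \<Rightarrow> ('m formal_sum \<Rightarrow> 'm formal_sum) \<Rightarrow> bool" where
  "star_automorphism \<Gamma> \<Lambda> \<phi> \<longleftrightarrow>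
     (let A = reduced_cross_product \<Gamma> \<Lambda> in
       bij_betw \<phi> A A \<and>
       (\<forall>a\<in>A. \<forall>b\<in>A. \<phi> (cp_add a b) = cp_add (\<phi> a) (\<phi> b)) \<and>
       (\<forall>z. \<forall>a\<in>A. \<phi> (cp_scale z a) = cp_scale z (\<phi> a)) \<and>
       (\<forall>a\<in>A. \<forall>b\<in>A. \<phi> (cp_mult \<Gamma> a b) = cp_mult \<Gamma> (\<phi> a) (\<phi> b)) \<and>
       (\<forall>a\<in>A. \<phi> (cp_star \<Gamma> \<Lambda> a) = cp_star \<Gamma> \<Lambda> (\<phi> a)))"

definition strongly_continuous_automorphism_group ::
    "('m::finite) isom set \<Rightarrow> 'm point set \<Rightarrow> (real \<Rightarrow> 'm formal_sum \<Rightarrow> 'm formal_sum) \<Rightarrow> bool" where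
  "strongly_continuous_automorphism_group \<Gamma> \<Lambda> \<alpha> \<longleftrightarrow>
     (\<forall>t. star_automorphism \<Gamma> \<Lambda> (\<alpha> t)) \<and>
     (\<forall>a\<in>reduced_cross_product \<Gamma> \<Lambda>. \<alpha> 0 a = a) \<and>
     (\<forall>s t. \<forall>a\<in>reduced_cross_product \<Gamma> \<Lambda>. \<alpha> (s + t) a = \<alpha> s (\<alpha> t a)) \<and>
     (\<forall>a\<in>reduced_cross_product \<Gamma> \<Lambda>. \<forall>t\<^sub>0.
        ((\<lambda>t. cp_norm \<Gamma> \<Lambda> (cp_diff (\<alpha> t a) (\<alpha> t\<^sub>0 a))) \<longlongrightarrow> 0) (at t\<^sub>0))"

definition flow :: "('m::finite) point \<Rightarrow> real \<Rightarrow> 'm formal_sum \<Rightarrow> 'm formal_sum" where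
  "flow x t f = (\<lambda>g \<xi>. exp (\<i> * of_real (t * busemann x ((inv\<^bsub>isom_plus\<^esub> g) x) \<xi>)) * f g \<xi>)"

end

theory Submission imports Defs begin

text \<open>
  A hyperbolic isometry of the ball is Lipschitz for the Euclidean metric, so it extends to the sphere
  at infinity without any classification of isometries. Hence \<open>D\<close> is invariant under isometries, and
  \<open>g \<mapsto> D(x, xg\<^sup>-\<^sup>1, \<xi>)\<close> is a continuous real cocycle of the action on the sphere. The cocycle identity
  makes \<open>\<alpha>\<^sub>t\<close> multiplicative and \<open>*\<close>-preserving, and shows that on each \<open>\<pi>\<^sup>\<xi>\<close> it is conjugation by a
  diagonal unitary, hence isometric. Strong continuity then reduces to finite sums, where it follows
  from compactness of the limit set.
\<close>

section \<open>Isometries of the ball at infinity\<close>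

text \<open>\<open>Lim\<close> and \<open>infsum\<close> are total: they return a value even without
  convergence. So \<open>bdry\<close> and \<open>busemann\<close> carry no information until a limit
  is proved to exist. For \<open>busemann\<close> an explicit formula, a difference of logarithms
  attached to the two points, yields convergence, additivity along chains of points and continuity
  in \<xi> together. For sums the difficulty is uneven. A scalar can be pulled out of an
  \<open>infsum\<close> in every case, so multiplicativity and the unitary conjugation are checked
  term by term. Sums of two families split only under summability, so the triangle inequality for
  \<open>cp_norm\<close> needs square-summable matrix rows; this is the purpose of the row estimate.
  The triangle inequality serves continuity in t: since the flow does not increase the norm,
  approximation by finite sums is uniform in t, and on a finite sum the flow is Lipschitz in t,
  because the phase changes at the rate of the cocycle.\<close>

text \<open>\<open>arcosh\<close> is injective on [1, \<infinity>), where its arguments lie. The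
  Euclidean estimates for isometries work with this ratio.\<close>

lemma hyp_dist_eq_iff:
  fixes x y u v :: "('m::finite) point"
  assumes "x \<in> hyp_space" "y \<in> hyp_space" "u \<in> hyp_space" "v \<in> hyp_space"
  shows "hyp_dist x y = hyp_dist u v \<longleftrightarrow>
    (norm (x - y))\<^sup>2 / ((1 - (norm x)\<^sup>2) * (1 - (norm y)\<^sup>2)) =
    (norm (u - v))\<^sup>2 / ((1 - (norm u)\<^sup>2) * (1 - (norm v)\<^sup>2))" (is "_ \<longleftrightarrow> ?r x y = ?r u v")
proof
  have pos: "1 - (norm z)\<^sup>2 > 0" if "z \<in> hyp_space" for z :: "'m point"
    using that by (simp add: abs_square_less_1)
  have ge: "1 + 2 * (norm (z - w))\<^sup>2 / ((1 - (norm z)\<^sup>2) * (1 - (norm w)\<^sup>2)) \<ge> 1"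
    if "z \<in> hyp_space" "w \<in> hyp_space" for z w :: "'m point"
    using pos[OF that(1)] pos[OF that(2)] by simp
  assume "hyp_dist x y = hyp_dist u v"
  then have "cosh (hyp_dist x y) = cosh (hyp_dist u v)"
    by simp
  then show "?r x y = ?r u v"
    unfolding hyp_dist_def cosh_arcosh_real[OF ge[OF assms(1,2)]] cosh_arcosh_real[OF ge[OF assms(3,4)]]
    by simp
next
  assume "?r x y = ?r u v"
  then show "hyp_dist x y = hyp_dist u v"
    unfolding hyp_dist_def times_divide_eq_right[symmetric] by simp
qed

text \<open>The metric part of membership in \<open>isom_plus\<close>, kept apart from
  extensionality and orientation so that it applies to \<open>inv_into\<close> before inverses are
  known to lie in the group.\<close>

definition hyp_isometry :: "('m::finite) isom \<Rightarrow> bool" where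
  "hyp_isometry g \<longleftrightarrow> bij_betw g hyp_space hyp_space \<and>
     (\<forall>x\<in>hyp_space. \<forall>y\<in>hyp_space. hyp_dist (g x) (g y) = hyp_dist x y)"

lemma hyp_isometry_mem: "hyp_isometry g \<Longrightarrow> x \<in> hyp_space \<Longrightarrow> g x \<in> hyp_space"
  unfolding hyp_isometry_def by (blast dest: bij_betwE)

text \<open>Compare \<open>d(0, g y)\<close> with \<open>d(p, y)\<close>, where \<open>g p = 0\<close>.\<close>
lemma hyp_isometry_defect:
  fixes g :: "('m::finite) isom"
  assumes "hyp_isometry g"
  obtains C where "C > 0" "\<And>y. y \<in> hyp_space \<Longrightarrow> 1 - (norm (g y))\<^sup>2 \<le> C * (1 - (norm y)\<^sup>2)"
proof -
  obtain p where p: "p \<in> hyp_space" "g p = 0"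
    using assms unfolding hyp_isometry_def bij_betw_def by (metis centre_in_ball image_iff zero_less_one)
  define a where "a = norm p"
  have a: "0 \<le> a" "a < 1"
    using p by (auto simp: a_def)
  \<comment> \<open>This is (1 - a^2) / (1 - a)^2: the factor 1 - a^2 comes from the distance
    formula, (1 - a)^2 from the lower bound on \<open>S\<close>.\<close>
  define C where "C = (1 + a) / (1 - a)"
  have "1 - (norm (g y))\<^sup>2 \<le> C * (1 - (norm y)\<^sup>2)" if y: "y \<in> hyp_space" for y
  proof -
    define b where "b = norm y"
    define G where "G = 1 - (norm (g y))\<^sup>2"
    have gy: "g y \<in> hyp_space"
      by (rule hyp_isometry_mem[OF assms y])
    then have G: "G > 0"
      by (simp add: G_def abs_square_less_1)
    have b: "0 \<le> b" "b < 1"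
      using y by (auto simp: b_def)
    have b2: "1 - b\<^sup>2 > 0" and a2: "1 - a\<^sup>2 > 0"
      using a b by (auto simp: abs_square_less_1)
    have "hyp_dist (g p) (g y) = hyp_dist p y"
      using assms p(1) y unfolding hyp_isometry_def by blast
    then have eq: "(norm (g y))\<^sup>2 / G = (norm (p - y))\<^sup>2 / ((1 - a\<^sup>2) * (1 - b\<^sup>2))"
      using hyp_dist_eq_iff[of "g p" "g y" p y] p y gy by (simp add: G_def a_def b_def)
    \<comment> \<open>Expanded, this is 1 - 2 p.y + |p|^2 |y|^2, the denominator in the Mobius
      formula for 1 - |g y|^2. It stays away from 0 because p is an interior point.\<close>
    define S where "S = (1 - a\<^sup>2) * (1 - b\<^sup>2) + (norm (p - y))\<^sup>2"
    have "(norm (p - y))\<^sup>2 \<ge> (a - b)\<^sup>2"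
      using norm_triangle_ineq3[of p y] by (simp add: a_def b_def abs_le_square_iff[symmetric])
    then have "S \<ge> (1 - a * b)\<^sup>2"
      by (simp add: S_def power2_eq_square algebra_simps)
    moreover have "a * b \<le> a"
      using a b by (simp add: mult_left_le)
    then have "(1 - a * b)\<^sup>2 \<ge> (1 - a)\<^sup>2"
      using a by (intro power_mono) auto
    ultimately have S: "S \<ge> (1 - a)\<^sup>2"
      by linarith
    have "1 / G = S / ((1 - a\<^sup>2) * (1 - b\<^sup>2))"
    proof -
      have "1 / G = 1 + (norm (g y))\<^sup>2 / G"
        using G by (simp add: G_def field_simps)
      also have "\<dots> = S / ((1 - a\<^sup>2) * (1 - b\<^sup>2))"
        unfolding eq S_def using a2 b2 by (simp add: add_divide_distrib)
      finally show ?thesis .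
    qed
    then have GS: "G * S = (1 - a\<^sup>2) * (1 - b\<^sup>2)"
      using G a2 b2 by (simp add: frac_eq_eq)
    have "G * (1 - a)\<^sup>2 \<le> (1 - a\<^sup>2) * (1 - b\<^sup>2)"
      using mult_left_mono[OF S, of G] G GS by simp
    also have "\<dots> = C * (1 - b\<^sup>2) * (1 - a)\<^sup>2"
      using a by (simp add: C_def power2_eq_square field_simps)
    finally show ?thesis
      using a by (simp add: G_def b_def)
  qed
  moreover have "C > 0"
    using a by (simp add: C_def)
  ultimately show ?thesis
    using that by blast
qed

text \<open>By invariance of the distance ratio, g multiplies |y - z|^2 by the product of the
  factors (1 - |g y|^2) / (1 - |y|^2) at y and at z. Each factor is at most C, so C itself is a
  Lipschitz constant.\<close>

lemma hyp_isometry_lipschitz: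
  fixes g :: "('m::finite) isom"
  assumes "hyp_isometry g"
  obtains C where "C-lipschitz_on hyp_space g"
proof -
  obtain C where C: "C > 0" "\<And>y. y \<in> hyp_space \<Longrightarrow> 1 - (norm (g y))\<^sup>2 \<le> C * (1 - (norm y)\<^sup>2)"
    using hyp_isometry_defect[OF assms] by metis
  have "C-lipschitz_on hyp_space g"
  proof (rule lipschitz_onI)
    fix y z :: "'m point"
    assume y: "y \<in> hyp_space" and z: "z \<in> hyp_space"
    let ?d = "\<lambda>x::'m point. 1 - (norm x)\<^sup>2"
    have pos: "?d x > 0" if "x \<in> hyp_space" for x
      using that by (simp add: abs_square_less_1)
    have gy: "g y \<in> hyp_space" and gz: "g z \<in> hyp_space"
      using hyp_isometry_mem[OF assms] y z by auto
    have nz: "?d (g y) * ?d (g z) \<noteq> 0"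
      using pos[OF gy] pos[OF gz] by simp
    have "(norm (g y - g z))\<^sup>2 / (?d (g y) * ?d (g z)) = (norm (y - z))\<^sup>2 / (?d y * ?d z)"
      using hyp_dist_eq_iff[OF gy gz y z] assms y z by (auto simp: hyp_isometry_def)
    then have "(norm (g y - g z))\<^sup>2 = (norm (y - z))\<^sup>2 * ((?d (g y) * ?d (g z)) / (?d y * ?d z))"
      unfolding nonzero_divide_eq_eq[OF nz] by (simp only: times_divide_eq_left times_divide_eq_right)
    also have "\<dots> \<le> (norm (y - z))\<^sup>2 * (C * C)"
    proof -
      have "?d (g y) * ?d (g z) \<le> (C * ?d y) * (C * ?d z)"
        using C(1) C(2)[OF y] C(2)[OF z] pos[OF y] pos[OF gz] by (intro mult_mono) auto
      then have "(?d (g y) * ?d (g z)) / (?d y * ?d z) \<le> C * C"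
        using pos[OF y] pos[OF z] by (simp add: divide_le_eq mult_ac)
      then show ?thesis
        by (rule mult_left_mono) simp
    qed
    finally have "(norm (g y - g z))\<^sup>2 \<le> (C * norm (y - z))\<^sup>2"
      by (simp add: power2_eq_square mult_ac)
    then show "dist (g y) (g z) \<le> C * dist y z"
      using C(1) by (auto simp: dist_norm dest: power2_le_imp_le)
  qed (use C in simp)
  then show ?thesis
    using that by blast
qed

text \<open>Limits are unique only along a nontrivial filter, so every evaluation of
  \<open>Lim\<close> relies on this.\<close>

lemma at_sphere_within_hyp_space_nontrivial:
  fixes \<xi> :: "('m::finite) point"
  assumes "\<xi> \<in> sphere_at_infinity"
  shows "at \<xi> within hyp_space \<noteq> bot"
  using assms by (simp add: trivial_limit_within islimpt_ball)

text \<open>Uniform continuity on the ball gives a limit at each point of the closure, and only then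
  does the \<open>Lim\<close> in \<open>bdry\<close> denote it.\<close>

lemma bdry_tendsto:
  fixes g :: "('m::finite) isom"
  assumes g: "hyp_isometry g" and \<xi>: "\<xi> \<in> sphere_at_infinity"
  shows "(g \<longlongrightarrow> bdry g \<xi>) (at \<xi> within hyp_space)"
proof -
  obtain C where "C-lipschitz_on hyp_space g"
    using hyp_isometry_lipschitz[OF g] .
  then have "uniformly_continuous_on hyp_space g"
    by (rule lipschitz_on_uniformly_continuous)
  moreover have "\<xi> \<in> closure hyp_space"
    using \<xi> by simp
  ultimately obtain l where l: "(g \<longlongrightarrow> l) (at \<xi> within hyp_space)"
    by (rule uniformly_continuous_on_extension_at_closure)
  then have "bdry g \<xi> = l"
    unfolding bdry_def by (rule tendsto_Lim[OF at_sphere_within_hyp_space_nontrivial[OF \<xi>]])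
  with l show ?thesis
    by simp
qed

text \<open>Pass to the limit in 0 \<le> 1 - |g y|^2 \<le> C (1 - |y|^2): the right side tends to
  0.\<close>

lemma bdry_in_sphere:
  fixes g :: "('m::finite) isom"
  assumes g: "hyp_isometry g" and \<xi>: "\<xi> \<in> sphere_at_infinity"
  shows "bdry g \<xi> \<in> sphere_at_infinity"
proof -
  let ?F = "at \<xi> within hyp_space"
  note nt = at_sphere_within_hyp_space_nontrivial[OF \<xi>]
  obtain C where C: "\<And>y. y \<in> hyp_space \<Longrightarrow> 1 - (norm (g y))\<^sup>2 \<le> C * (1 - (norm y)\<^sup>2)"
    using hyp_isometry_defect[OF g] by metis
  have in_ball: "\<forall>\<^sub>F y in ?F. y \<in> hyp_space"
    by (simp add: eventually_at_filter)
  have lim: "((\<lambda>y. 1 - (norm (g y))\<^sup>2) \<longlongrightarrow> 1 - (norm (bdry g \<xi>))\<^sup>2) ?F"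
    by (intro tendsto_intros bdry_tendsto g \<xi>)
  have "((\<lambda>y. C * (1 - (norm y)\<^sup>2)) \<longlongrightarrow> C * (1 - (norm \<xi>)\<^sup>2)) ?F"
    by (intro tendsto_intros)
  then have upper: "1 - (norm (bdry g \<xi>))\<^sup>2 \<le> C * (1 - (norm \<xi>)\<^sup>2)"
    by (rule tendsto_le[OF nt _ lim]) (use C in_ball in \<open>auto elim: eventually_mono\<close>)
  have "0 \<le> 1 - (norm (bdry g \<xi>))\<^sup>2"
  proof (rule tendsto_lowerbound[OF lim _ nt])
    show "\<forall>\<^sub>F y in ?F. 0 \<le> 1 - (norm (g y))\<^sup>2"
      using in_ball by eventually_elim
        (use hyp_isometry_mem[OF g] in \<open>force simp: abs_square_le_1\<close>)
  qed
  with upper \<xi> have "(norm (bdry g \<xi>))\<^sup>2 = 1"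
    by simp
  then show ?thesis
    by (simp add: power2_eq_1_iff)
      (metis norm_ge_zero not_one_le_zero neg_0_le_iff_le zero_le_one order_trans)
qed

section \<open>The Busemann function\<close>

text \<open>
  With \<open>\<delta> = 1 - |y|\<^sup>2\<close> and \<open>a = |x - y|\<^sup>2 / (1 - |x|\<^sup>2)\<close>, expanding \<open>arcosh\<close> gives
  \<open>d(x, y) = ln (\<delta> + 2a + sqrt ((\<delta> + 2a)\<^sup>2 - \<delta>\<^sup>2)) - ln \<delta>\<close>; the divergent term does not depend on \<open>x\<close>.
\<close>
lemma hyp_dist_plus_ln_tendsto:
  fixes x \<xi> :: "('m::finite) point"
  assumes x: "x \<in> hyp_space" and \<xi>: "\<xi> \<in> sphere_at_infinity"
  shows "((\<lambda>y. hyp_dist x y + ln (1 - (norm y)\<^sup>2)) \<longlongrightarrow>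
    ln (4 * ((norm (x - \<xi>))\<^sup>2 / (1 - (norm x)\<^sup>2)))) (at \<xi> within hyp_space)"
proof -
  let ?F = "at \<xi> within hyp_space"
  define d where "d y = 1 - (norm y)\<^sup>2" for y :: "'m point"
  define a where "a y = (norm (x - y))\<^sup>2 / d x" for y
  have pos: "d y > 0" if "y \<in> hyp_space" for y
    using that by (simp add: d_def abs_square_less_1)
  \<comment> \<open>Unlike the distance, this expression stays finite at \<xi>: there
    \<open>d\<close> vanishes, the root becomes 2 a, and the logarithm is taken at 4 a > 0.\<close>
  define h where "h y = ln (d y + 2 * a y + sqrt ((d y + 2 * a y)\<^sup>2 - (d y)\<^sup>2))" for y
  have "x \<noteq> \<xi>"
    using x \<xi> by auto
  then have a\<xi>: "a \<xi> > 0"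
    using pos[OF x] by (simp add: a_def)
  have d\<xi>: "d \<xi> = 0"
    using \<xi> by (simp add: d_def)
  have tends: "(d \<longlongrightarrow> d \<xi>) ?F" "(a \<longlongrightarrow> a \<xi>) ?F"
    unfolding d_def a_def using pos[OF x] by (auto intro!: tendsto_intros simp: d_def)
  have "(h \<longlongrightarrow> h \<xi>) ?F"
    unfolding h_def by (intro tendsto_intros tends) (use a\<xi> in \<open>simp add: d\<xi> real_sqrt_mult\<close>)
  also have "h \<xi> = ln (4 * a \<xi>)"
    using a\<xi> by (simp add: h_def d\<xi> real_sqrt_mult)
  finally have lim: "(h \<longlongrightarrow> ln (4 * a \<xi>)) ?F" .
  have eq: "h y = hyp_dist x y + ln (d y)" if y: "y \<in> hyp_space" for y
  proof -
    define u where "u = 1 + 2 * a y / d y"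
    have ay: "a y \<ge> 0"
      using pos[OF x] by (simp add: a_def)
    have u: "u \<ge> 1"
      using ay pos[OF y] by (simp add: u_def)
    have "hyp_dist x y = arcosh u"
      by (simp add: hyp_dist_def u_def a_def d_def)
    also have "\<dots> = ln (u + sqrt (u\<^sup>2 - 1))"
      by (rule arcosh_real_def[OF u])
    also have "\<dots> + ln (d y) = ln ((u + sqrt (u\<^sup>2 - 1)) * d y)"
    proof -
      have "u + sqrt (u\<^sup>2 - 1) > 0"
        using u by (intro add_pos_nonneg) auto
      then show ?thesis
        using pos[OF y] by (simp add: ln_mult)
    qed
    also have "sqrt (u\<^sup>2 - 1) * d y = sqrt ((u * d y)\<^sup>2 - (d y)\<^sup>2)"
    proof -
      have "sqrt (u\<^sup>2 - 1) * d y = sqrt ((u\<^sup>2 - 1) * (d y)\<^sup>2)"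
        using pos[OF y] by (simp add: real_sqrt_mult)
      then show ?thesis
        by (simp add: power_mult_distrib left_diff_distrib)
    qed
    then have "(u + sqrt (u\<^sup>2 - 1)) * d y = u * d y + sqrt ((u * d y)\<^sup>2 - (d y)\<^sup>2)"
      by (simp add: distrib_right)
    also have "u * d y = d y + 2 * a y"
      using pos[OF y] by (simp add: u_def field_simps)
    finally show ?thesis
      by (simp add: h_def)
  qed
  have "\<forall>\<^sub>F y in ?F. h y = hyp_dist x y + ln (d y)"
    using eq by (simp add: eventually_at_filter)
  from Lim_transform_eventually[OF lim this] show ?thesis
    by (simp add: d_def a_def)
qed

lemma busemann_tendsto_formula:
  fixes x x' \<xi> :: "('m::finite) point"
  assumes x: "x \<in> hyp_space" and x': "x' \<in> hyp_space" and \<xi>: "\<xi> \<in> sphere_at_infinity"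
  shows "((\<lambda>y. hyp_dist x y - hyp_dist x' y) \<longlongrightarrow>
      ln (4 * ((norm (x - \<xi>))\<^sup>2 / (1 - (norm x)\<^sup>2))) - ln (4 * ((norm (x' - \<xi>))\<^sup>2 / (1 - (norm x')\<^sup>2))))
    (at \<xi> within hyp_space)"
  using tendsto_diff[OF hyp_dist_plus_ln_tendsto[OF x \<xi>] hyp_dist_plus_ln_tendsto[OF x' \<xi>]] by simp

text \<open>With P(z) = (1 - |z|^2) / |z - \<xi>|^2, the Poisson kernel up to a power, this says
  D(x, x', \<xi>) = ln P(x') - ln P(x). A difference of values of one function telescopes, which is
  the additivity used below.\<close>

lemma busemann_eq:
  fixes x x' \<xi> :: "('m::finite) point"
  assumes "x \<in> hyp_space" "x' \<in> hyp_space" "\<xi> \<in> sphere_at_infinity"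
  shows "busemann x x' \<xi> =
    ln (4 * ((norm (x - \<xi>))\<^sup>2 / (1 - (norm x)\<^sup>2))) - ln (4 * ((norm (x' - \<xi>))\<^sup>2 / (1 - (norm x')\<^sup>2)))"
  unfolding busemann_def
  by (rule tendsto_Lim[OF at_sphere_within_hyp_space_nontrivial busemann_tendsto_formula]) fact+

lemma busemann_tendsto:
  fixes x x' \<xi> :: "('m::finite) point"
  assumes "x \<in> hyp_space" "x' \<in> hyp_space" "\<xi> \<in> sphere_at_infinity"
  shows "((\<lambda>y. hyp_dist x y - hyp_dist x' y) \<longlongrightarrow> busemann x x' \<xi>) (at \<xi> within hyp_space)"
  using busemann_tendsto_formula[OF assms] busemann_eq[OF assms] by simp

lemma busemann_cocycle:
  fixes x y z :: "('m::finite) point"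
  assumes "x \<in> hyp_space" "y \<in> hyp_space" "z \<in> hyp_space" "\<xi> \<in> sphere_at_infinity"
  shows "busemann x z \<xi> = busemann x y \<xi> + busemann y z \<xi>"
  using assms by (simp add: busemann_eq)

lemma continuous_on_busemann:
  fixes x y :: "('m::finite) point"
  assumes x: "x \<in> hyp_space" and y: "y \<in> hyp_space"
  shows "continuous_on sphere_at_infinity (busemann x y)"
proof -
  have pos: "(norm (z - \<xi>))\<^sup>2 / (1 - (norm z)\<^sup>2) > 0" and "1 - (norm z)\<^sup>2 \<noteq> 0"
    if "z \<in> hyp_space" "\<xi> \<in> sphere_at_infinity" for z \<xi> :: "'m point"
  proof -
    have "1 - (norm z)\<^sup>2 > 0"
      using that by (simp add: abs_square_less_1)
    moreover have "z \<noteq> \<xi>"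
      using that by auto
    ultimately show "(norm (z - \<xi>))\<^sup>2 / (1 - (norm z)\<^sup>2) > 0" "1 - (norm z)\<^sup>2 \<noteq> 0"
      by simp_all
  qed
  have cont: "continuous_on sphere_at_infinity (\<lambda>\<xi>. ln (4 * ((norm (z - \<xi>))\<^sup>2 / (1 - (norm z)\<^sup>2))))"
    if z: "z \<in> hyp_space" for z :: "'m point"
  proof (intro continuous_intros ballI)
    fix \<xi> :: "'m point"
    assume \<xi>: "\<xi> \<in> sphere_at_infinity"
    show "4 * ((norm (z - \<xi>))\<^sup>2 / (1 - (norm z)\<^sup>2)) \<noteq> 0"
      using pos[OF z \<xi>] by (metis less_irrefl mult_eq_0_iff zero_neq_numeral)
    then show "1 - (norm z)\<^sup>2 \<noteq> 0"
      by auto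
  qed
  have "continuous_on sphere_at_infinity (\<lambda>\<xi>. ln (4 * ((norm (x - \<xi>))\<^sup>2 / (1 - (norm x)\<^sup>2)))
      - ln (4 * ((norm (y - \<xi>))\<^sup>2 / (1 - (norm y)\<^sup>2))))"
    by (intro continuous_on_diff cont x y)
  then show ?thesis
    by (rule continuous_on_eq) (simp add: busemann_eq[OF x y])
qed

text \<open>The limit defining the left side may be taken along points g z with z tending to \<xi>,
  and there the distances equal those from x and y to z.\<close>

lemma busemann_bdry:
  fixes g :: "('m::finite) isom"
  assumes g: "hyp_isometry g" and x: "x \<in> hyp_space" and y: "y \<in> hyp_space"
    and \<xi>: "\<xi> \<in> sphere_at_infinity"
  shows "busemann (g x) (g y) (bdry g \<xi>) = busemann x y \<xi>"
proof -
  let ?F = "at \<xi> within hyp_space"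
  have g\<xi>: "bdry g \<xi> \<in> sphere_at_infinity"
    by (rule bdry_in_sphere[OF g \<xi>])
  have in_ball: "\<forall>\<^sub>F z in ?F. z \<in> hyp_space"
    by (simp add: eventually_at_filter)
  have "filterlim g (at (bdry g \<xi>) within hyp_space) ?F"
    unfolding filterlim_at
  proof
    \<comment> \<open>The target filter is punctured; an interior point never equals the limit,
      which lies on the sphere.\<close>
    show "\<forall>\<^sub>F z in ?F. g z \<in> hyp_space \<and> g z \<noteq> bdry g \<xi>"
      using in_ball
      by eventually_elim (use g\<xi> hyp_isometry_mem[OF g] in force)
  qed (rule bdry_tendsto[OF g \<xi>])
  from filterlim_compose[OF busemann_tendsto this]
  have "((\<lambda>z. hyp_dist (g x) (g z) - hyp_dist (g y) (g z)) \<longlongrightarrow> busemann (g x) (g y) (bdry g \<xi>)) ?F"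
    using g\<xi> hyp_isometry_mem[OF g] x y by blast
  moreover have "\<forall>\<^sub>F z in ?F. hyp_dist (g x) (g z) - hyp_dist (g y) (g z) = hyp_dist x z - hyp_dist y z"
    using in_ball by eventually_elim (use g x y in \<open>simp add: hyp_isometry_def\<close>)
  ultimately have "((\<lambda>z. hyp_dist x z - hyp_dist y z) \<longlongrightarrow> busemann (g x) (g y) (bdry g \<xi>)) ?F"
    by (rule Lim_transform_eventually)
  then show ?thesis
    using tendsto_unique[OF at_sphere_within_hyp_space_nontrivial[OF \<xi>]]
      busemann_tendsto[OF x y \<xi>] by blast
qed

section \<open>The isometry group\<close>

lemma hyp_isometry_inv_into:
  assumes "hyp_isometry g"
  shows "hyp_isometry (inv_into hyp_space g)"
  unfolding hyp_isometry_def
proof (intro conjI ballI)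
  have bij: "bij_betw g hyp_space hyp_space"
    using assms by (simp add: hyp_isometry_def)
  then show "bij_betw (inv_into hyp_space g) hyp_space hyp_space"
    by (rule bij_betw_inv_into)
  fix x y :: "'a point"
  assume "x \<in> hyp_space" "y \<in> hyp_space"
  then have "x \<in> g ` hyp_space" "y \<in> g ` hyp_space"
    using bij_betw_imp_surj_on[OF bij] by simp_all
  then obtain x' y' where "x' \<in> hyp_space" "y' \<in> hyp_space" "x = g x'" "y = g y'"
    by blast
  then show "hyp_dist (inv_into hyp_space g x) (inv_into hyp_space g y) = hyp_dist x y"
    using assms bij by (simp add: hyp_isometry_def bij_betw_inv_into_left)
qed

text \<open>Group elements are \<open>undefined\<close> off the ball. The ball is open, so
  derivatives at its points do not see those values.\<close>

lemma has_derivative_eq_on_hyp_space: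
  fixes g h :: "('m::finite) isom"
  assumes "(g has_derivative g') (at x)" "x \<in> hyp_space" "\<And>y. y \<in> hyp_space \<Longrightarrow> g y = h y"
  shows "(h has_derivative g') (at x)"
  by (rule has_derivative_transform_within_open[OF assms(1) open_ball assms(2)]) (use assms in blast)

text \<open>A positive determinant makes the derivative of g invertible, and the inverse map is
  continuous by its own Lipschitz bound. Hence it is differentiable, with the inverse derivative and
  the reciprocal determinant.\<close>

lemma orientation_preserving_inv_into:
  fixes g :: "('m::finite) isom"
  assumes g: "hyp_isometry g" and o: "orientation_preserving g"
  shows "orientation_preserving (inv_into hyp_space g)"
  unfolding orientation_preserving_def
proof
  let ?h = "inv_into hyp_space g"
  have bij: "bij_betw g hyp_space hyp_space"
    using g by (simp add: hyp_isometry_def)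
  have h: "hyp_isometry ?h"
    by (rule hyp_isometry_inv_into[OF g])
  fix y :: "'m point"
  assume y: "y \<in> hyp_space"
  have hy: "?h y \<in> hyp_space"
    by (rule hyp_isometry_mem[OF h y])
  then obtain g' where g': "(g has_derivative g') (at (?h y))" "det (matrix g') > 0"
    using o hy unfolding orientation_preserving_def by blast
  have lin: "linear g'"
    using g'(1) has_derivative_linear by blast
  have "inj g'"
    using g'(2) det_nz_iff_inj[OF lin] by simp
  then obtain k where "linear k" "\<forall>x. k (g' x) = x" "\<forall>x. g' (k x) = x"
    using linear_injective_isomorphism[OF lin] by blast
  then have k: "linear k" "k \<circ> g' = id" "g' \<circ> k = id"
    by (simp_all add: fun_eq_iff)
  obtain C where "C-lipschitz_on hyp_space ?h"
    using hyp_isometry_lipschitz[OF h] .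
  then have "continuous_on hyp_space ?h"
    by (rule lipschitz_on_continuous_on)
  then have cont: "continuous (at y) ?h"
    using y by (simp add: continuous_on_eq_continuous_at)
  have "(?h has_derivative k) (at y)"
    by (rule has_derivative_inverse_basic[where g = ?h, OF g'(1) _ k(2) cont open_ball y])
      (use k bij in \<open>auto simp: linear_conv_bounded_linear bij_betw_inv_into_right\<close>)
  moreover have "matrix g' ** matrix k = mat 1"
    using k(3) matrix_compose[OF k(1) lin] by (simp add: matrix_id_mat_1)
  then have "det (matrix g') * det (matrix k) = 1"
    by (metis det_mul det_I)
  then have "det (matrix k) > 0"
    using g'(2) by (metis zero_less_mult_pos zero_less_one)
  ultimately show "\<exists>k. (?h has_derivative k) (at y) \<and> det (matrix k) > 0"
    by blast
qed

lemma orientation_preserving_compose: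
  fixes g h :: "('m::finite) isom"
  assumes g: "hyp_isometry g" and og: "orientation_preserving g" and oh: "orientation_preserving h"
  shows "orientation_preserving (h \<circ> g)"
  unfolding orientation_preserving_def
proof
  fix x :: "'m point"
  assume x: "x \<in> hyp_space"
  obtain g' where g': "(g has_derivative g') (at x)" "det (matrix g') > 0"
    using og x unfolding orientation_preserving_def by blast
  obtain h' where h': "(h has_derivative h') (at (g x))" "det (matrix h') > 0"
    using oh hyp_isometry_mem[OF g x] unfolding orientation_preserving_def by blast
  have "(h \<circ> g has_derivative h' \<circ> g') (at x)"
    by (rule diff_chain_at[OF g'(1) h'(1)])
  moreover have "det (matrix (h' \<circ> g')) > 0"
    using g' h' by (simp add: matrix_compose has_derivative_linear det_mul)
  ultimately show "\<exists>k. (h \<circ> g has_derivative k) (at x) \<and> det (matrix k) > 0"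
    by blast
qed

lemma orientation_preserving_cong:
  assumes "\<And>x. x \<in> hyp_space \<Longrightarrow> g x = h x" "orientation_preserving g"
  shows "orientation_preserving h"
  using assms has_derivative_eq_on_hyp_space unfolding orientation_preserving_def by metis

lemma carrier_isom_plus:
  "g \<in> carrier isom_plus \<longleftrightarrow> g \<in> extensional hyp_space \<and> hyp_isometry g \<and> orientation_preserving g"
  by (auto simp: isom_plus_def hyp_isometry_def)

lemma isom_plus_mult: "x \<in> hyp_space \<Longrightarrow> (g \<otimes>\<^bsub>isom_plus\<^esub> h) x = h (g x)"
  by (simp add: isom_plus_def compose_eq)

lemma isom_plus_one: "x \<in> hyp_space \<Longrightarrow> \<one>\<^bsub>isom_plus\<^esub> x = x"
  by (simp add: isom_plus_def)

text \<open>\<open>isom_plus\<close> is given as a bare record; the group laws are what make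
  \<open>inv\<close> the inverse isometry and license the cancellations in the cocycle and matrix
  computations.\<close>

lemma group_isom_plus: "group (isom_plus :: ('m::finite) isom monoid)"
proof (rule groupI)
  fix f g :: "'m isom"
  assume f: "f \<in> carrier isom_plus" and g: "g \<in> carrier isom_plus"
  have fg: "hyp_isometry f" "hyp_isometry g"
    using f g by (auto simp: carrier_isom_plus)
  have eq: "f \<otimes>\<^bsub>isom_plus\<^esub> g = compose hyp_space g f"
    by (simp add: isom_plus_def)
  have "hyp_isometry (compose hyp_space g f)"
    unfolding hyp_isometry_def
  proof (intro conjI ballI)
    show "bij_betw (compose hyp_space g f) hyp_space hyp_space"
      using fg by (auto simp: hyp_isometry_def intro: bij_betw_compose)
  next
    fix x y :: "'m point"
    assume "x \<in> hyp_space" "y \<in> hyp_space"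
    then show "hyp_dist (compose hyp_space g f x) (compose hyp_space g f y) = hyp_dist x y"
      using fg hyp_isometry_mem[OF fg(1)] by (simp add: hyp_isometry_def compose_eq)
  qed
  moreover have "orientation_preserving (compose hyp_space g f)"
    by (rule orientation_preserving_cong[OF _ orientation_preserving_compose[of f g]])
      (use f g in \<open>auto simp: carrier_isom_plus compose_eq\<close>)
  ultimately show "f \<otimes>\<^bsub>isom_plus\<^esub> g \<in> carrier isom_plus"
    unfolding eq carrier_isom_plus by (simp add: compose_extensional)
next
  have "orientation_preserving (\<lambda>x::'m point. x)"
    unfolding orientation_preserving_def
    by (intro ballI exI[of _ "\<lambda>x. x"]) (simp add: matrix_id_mat_1[unfolded id_def])
  then have "orientation_preserving (\<lambda>x\<in>hyp_space. x :: 'm point)"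
    by (rule orientation_preserving_cong[rotated]) simp
  then show "\<one>\<^bsub>isom_plus\<^esub> \<in> carrier (isom_plus :: 'm isom monoid)"
    by (auto simp: isom_plus_def bij_betw_def inj_on_def)
next
  fix f g h :: "'m isom"
  assume "f \<in> carrier isom_plus" "g \<in> carrier isom_plus" "h \<in> carrier isom_plus"
  \<comment> \<open>\<open>compose\<close> restricts to the ball, so associativity requires the map
    applied first to stay inside it.\<close>
  then have "f \<in> hyp_space \<rightarrow> hyp_space"
    by (auto simp: carrier_isom_plus simp del: mem_ball_0 intro: hyp_isometry_mem)
  then show "f \<otimes>\<^bsub>isom_plus\<^esub> g \<otimes>\<^bsub>isom_plus\<^esub> h = f \<otimes>\<^bsub>isom_plus\<^esub> (g \<otimes>\<^bsub>isom_plus\<^esub> h)"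
    by (simp add: isom_plus_def compose_assoc)
next
  fix g :: "'m isom"
  assume g: "g \<in> carrier isom_plus"
  then show "\<one>\<^bsub>isom_plus\<^esub> \<otimes>\<^bsub>isom_plus\<^esub> g = g"
    by (auto simp: isom_plus_def compose_def fun_eq_iff extensional_def restrict_def)
next
  fix g :: "'m isom"
  assume g: "g \<in> carrier isom_plus"
  let ?h = "\<lambda>x\<in>hyp_space. inv_into hyp_space g x"
  have iso: "hyp_isometry g"
    using g by (simp add: carrier_isom_plus)
  have "orientation_preserving ?h"
    by (rule orientation_preserving_cong[OF _ orientation_preserving_inv_into[of g]])
      (use g in \<open>auto simp: carrier_isom_plus\<close>)
  moreover have "hyp_isometry ?h"
    using hyp_isometry_inv_into[OF iso] unfolding hyp_isometry_def
    by (simp add: bij_betw_restrict_eq del: mem_ball_0 restrict_apply) simp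
  ultimately have "?h \<in> carrier isom_plus"
    by (simp add: carrier_isom_plus)
  moreover have "?h \<otimes>\<^bsub>isom_plus\<^esub> g = \<one>\<^bsub>isom_plus\<^esub>"
    using iso by (auto simp: isom_plus_def compose_def fun_eq_iff hyp_isometry_def bij_betw_inv_into_right
        restrict_def)
  ultimately show "\<exists>h\<in>carrier isom_plus. h \<otimes>\<^bsub>isom_plus\<^esub> g = \<one>\<^bsub>isom_plus\<^esub>"
    by blast
qed

section \<open>Square-summable functions and the norm of the cross-product\<close>

text \<open>A finite bound forces summability, since \<open>l2_norm\<close> is infinite otherwise.
  Estimates thereby move to finite sets, where \<open>L2_set\<close> has monotonicity and the
  Minkowski inequality.\<close>

lemma l2_norm_le_iff:
  fixes B :: real
  assumes B: "0 \<le> B"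
  shows "l2_norm \<Gamma> c \<le> ennreal B \<longleftrightarrow>
    (\<forall>F. finite F \<and> F \<subseteq> \<Gamma> \<longrightarrow> L2_set (\<lambda>\<gamma>. cmod (c \<gamma>)) F \<le> B)"
proof
  assume le: "l2_norm \<Gamma> c \<le> ennreal B"
  then have s: "(\<lambda>\<gamma>. (cmod (c \<gamma>))\<^sup>2) summable_on \<Gamma>"
    by (auto simp: l2_norm_def top_unique split: if_splits)
  with le B have "sqrt (\<Sum>\<^sub>\<infinity>\<gamma>\<in>\<Gamma>. (cmod (c \<gamma>))\<^sup>2) \<le> B"
    by (simp add: l2_norm_def)
  moreover have "L2_set (\<lambda>\<gamma>. cmod (c \<gamma>)) F \<le> sqrt (\<Sum>\<^sub>\<infinity>\<gamma>\<in>\<Gamma>. (cmod (c \<gamma>))\<^sup>2)"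
    if "finite F" "F \<subseteq> \<Gamma>" for F
    unfolding L2_set_def using finite_sum_le_infsum[OF s that] by simp
  ultimately show "\<forall>F. finite F \<and> F \<subseteq> \<Gamma> \<longrightarrow> L2_set (\<lambda>\<gamma>. cmod (c \<gamma>)) F \<le> B"
    by (meson order_trans)
next
  assume fin: "\<forall>F. finite F \<and> F \<subseteq> \<Gamma> \<longrightarrow> L2_set (\<lambda>\<gamma>. cmod (c \<gamma>)) F \<le> B"
  have le: "(\<Sum>\<gamma>\<in>F. (cmod (c \<gamma>))\<^sup>2) \<le> B\<^sup>2" if "finite F" "F \<subseteq> \<Gamma>" for F
    using fin that unfolding L2_set_def by (simp add: sqrt_le_D)
  have s: "(\<lambda>\<gamma>. (cmod (c \<gamma>))\<^sup>2) summable_on \<Gamma>"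
    by (rule nonneg_bdd_above_summable_on) (use le in \<open>auto simp: bdd_above_def\<close>)
  have "(\<Sum>\<^sub>\<infinity>\<gamma>\<in>\<Gamma>. (cmod (c \<gamma>))\<^sup>2) \<le> B\<^sup>2"
    by (rule infsum_le_finite_sums[OF s le])
  then show "l2_norm \<Gamma> c \<le> ennreal B"
    using s B by (simp add: l2_norm_def real_le_lsqrt ennreal_leI)
qed

lemma l2_norm_cong:
  assumes "\<And>\<gamma>. \<gamma> \<in> \<Gamma> \<Longrightarrow> cmod (c \<gamma>) = cmod (c' \<gamma>)"
  shows "l2_norm \<Gamma> c = l2_norm \<Gamma> c'"
proof -
  have "(\<lambda>\<gamma>. (cmod (c \<gamma>))\<^sup>2) summable_on \<Gamma> \<longleftrightarrow> (\<lambda>\<gamma>. (cmod (c' \<gamma>))\<^sup>2) summable_on \<Gamma>"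
    by (rule summable_on_cong) (use assms in auto)
  moreover have "(\<Sum>\<^sub>\<infinity>\<gamma>\<in>\<Gamma>. (cmod (c \<gamma>))\<^sup>2) = (\<Sum>\<^sub>\<infinity>\<gamma>\<in>\<Gamma>. (cmod (c' \<gamma>))\<^sup>2)"
    by (rule infsum_cong) (use assms in auto)
  ultimately show ?thesis
    by (simp add: l2_norm_def)
qed

lemma cp_norm_le_iff:
  fixes B :: ennreal
  shows "cp_norm \<Gamma> \<Lambda> f \<le> B \<longleftrightarrow>
    (\<forall>\<xi>\<in>\<Lambda>. \<forall>c\<in>l2 \<Gamma>. l2_norm \<Gamma> c \<le> 1 \<longrightarrow> l2_norm \<Gamma> (cp_rep \<Gamma> \<xi> f c) \<le> B)"
  by (auto simp: cp_norm_def op_norm_def SUP_le_iff)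

section \<open>Matrix rows and the triangle inequality\<close>

definition cp_matrix :: "('m::finite) point \<Rightarrow> 'm formal_sum \<Rightarrow> 'm isom \<Rightarrow> 'm isom \<Rightarrow> complex" where
  "cp_matrix \<xi> f \<gamma> \<gamma>' = f (\<gamma> \<otimes>\<^bsub>isom_plus\<^esub> inv\<^bsub>isom_plus\<^esub> \<gamma>') (bdry (inv\<^bsub>isom_plus\<^esub> \<gamma>) \<xi>)"

lemma cp_rep_eq:
  "cp_rep \<Gamma> \<xi> f c = (\<lambda>\<gamma>. if \<gamma> \<in> \<Gamma> then \<Sum>\<^sub>\<infinity>\<gamma>'\<in>\<Gamma>. cp_matrix \<xi> f \<gamma> \<gamma>' * c \<gamma>' else 0)"
  unfolding cp_rep_def cp_matrix_def by (rule refl)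

text \<open>Test on the normalized conjugate of the row, cut off to \<open>F\<close>.\<close>
lemma L2_set_row_le:
  fixes B :: real
  assumes norm: "cp_norm \<Gamma> \<Lambda> f \<le> ennreal B" and B: "0 \<le> B"
    and \<xi>: "\<xi> \<in> \<Lambda>" and \<gamma>: "\<gamma> \<in> \<Gamma>" and F: "finite F" "F \<subseteq> \<Gamma>"
  shows "L2_set (\<lambda>\<gamma>'. cmod (cp_matrix \<xi> f \<gamma> \<gamma>')) F \<le> B"
proof (cases "L2_set (\<lambda>\<gamma>'. cmod (cp_matrix \<xi> f \<gamma> \<gamma>')) F = 0")
  \<comment> \<open>A vanishing row cannot be normalized, but then the bound is trivial.\<close>
  case True
  then show ?thesis
    using B by simp
next
  case False
  define r where "r = cp_matrix \<xi> f \<gamma>"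
  define s where "s = L2_set (\<lambda>\<gamma>'. cmod (r \<gamma>')) F"
  define c where "c \<gamma>' = (if \<gamma>' \<in> F then cnj (r \<gamma>') / of_real s else 0)" for \<gamma>'
  have s: "s > 0"
    using False L2_set_nonneg[of "\<lambda>\<gamma>'. cmod (r \<gamma>')" F] unfolding s_def r_def by linarith
  have s2: "(\<Sum>\<gamma>'\<in>F. (cmod (r \<gamma>'))\<^sup>2) = s\<^sup>2"
    unfolding s_def L2_set_def by (simp add: sum_nonneg)
  have le1: "L2_set (\<lambda>\<gamma>'. cmod (c \<gamma>')) E \<le> 1" if "finite E" "E \<subseteq> \<Gamma>" for E
  proof -
    have "(\<Sum>\<gamma>'\<in>E. (cmod (c \<gamma>'))\<^sup>2) = (\<Sum>\<gamma>'\<in>E \<inter> F. (cmod (c \<gamma>'))\<^sup>2)"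
      by (rule sum.mono_neutral_right) (use that in \<open>auto simp: c_def\<close>)
    also have "\<dots> \<le> (\<Sum>\<gamma>'\<in>F. (cmod (c \<gamma>'))\<^sup>2)"
      by (rule sum_mono2) (use F in auto)
    also have "\<dots> = (\<Sum>\<gamma>'\<in>F. (cmod (r \<gamma>'))\<^sup>2) / s\<^sup>2"
      using s by (simp add: c_def norm_divide power_divide sum_divide_distrib)
    also have "\<dots> = 1"
      using s by (simp add: s2)
    finally show ?thesis
      by (simp add: L2_set_def)
  qed
  then have c1: "l2_norm \<Gamma> c \<le> 1"
    using l2_norm_le_iff[of 1 \<Gamma> c] by simp
  moreover have "c \<in> l2 \<Gamma>"
  proof -
    have "(\<lambda>\<gamma>. (cmod (c \<gamma>))\<^sup>2) summable_on \<Gamma>"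
      using c1 by (auto simp: l2_norm_def top_unique split: if_splits)
    then show ?thesis
      using F by (auto simp: l2_def c_def)
  qed
  ultimately have "l2_norm \<Gamma> (cp_rep \<Gamma> \<xi> f c) \<le> ennreal B"
    using norm \<xi> by (auto simp: cp_norm_le_iff)
  then have "L2_set (\<lambda>\<gamma>. cmod (cp_rep \<Gamma> \<xi> f c \<gamma>)) {\<gamma>} \<le> B"
    using \<gamma> unfolding l2_norm_le_iff[OF B] by blast
  then have "cmod (cp_rep \<Gamma> \<xi> f c \<gamma>) \<le> B"
    by simp
  \<comment> \<open>Each term is |r|^2 / s, so the length s of the truncated row appears as one
    coordinate of the image vector, whose norm is at most B.\<close>
  moreover have "cp_rep \<Gamma> \<xi> f c \<gamma> = of_real s"
  proof -
    have "cp_rep \<Gamma> \<xi> f c \<gamma> = (\<Sum>\<^sub>\<infinity>\<gamma>'\<in>\<Gamma>. r \<gamma>' * c \<gamma>')"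
      using \<gamma> by (simp add: cp_rep_eq r_def)
    also have "\<dots> = (\<Sum>\<^sub>\<infinity>\<gamma>'\<in>F. r \<gamma>' * c \<gamma>')"
      by (rule infsum_cong_neutral) (use F in \<open>auto simp: c_def\<close>)
    also have "\<dots> = (\<Sum>\<gamma>'\<in>F. r \<gamma>' * c \<gamma>')"
      using F by simp
    also have "\<dots> = (\<Sum>\<gamma>'\<in>F. of_real ((cmod (r \<gamma>'))\<^sup>2) / of_real s)"
      by (rule sum.cong) (simp_all add: c_def complex_norm_square[symmetric])
    also have "\<dots> = of_real ((\<Sum>\<gamma>'\<in>F. (cmod (r \<gamma>'))\<^sup>2) / s)"
      by (simp add: sum_divide_distrib)
    also have "\<dots> = of_real s"
      unfolding s2 using s by (simp add: power2_eq_square)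
    finally show ?thesis .
  qed
  ultimately show ?thesis
    using s by (simp add: s_def r_def)
qed

text \<open>Finite norm puts each row in l2, and the product of two l2 families is absolutely
  summable. This is the condition under which the sums in \<open>cp_rep\<close> may be
  added.\<close>

lemma row_times_l2_summable:
  assumes norm: "cp_norm \<Gamma> \<Lambda> f < \<infinity>" and \<xi>: "\<xi> \<in> \<Lambda>" and \<gamma>: "\<gamma> \<in> \<Gamma>" and c: "c \<in> l2 \<Gamma>"
  shows "(\<lambda>\<gamma>'. cp_matrix \<xi> f \<gamma> \<gamma>' * c \<gamma>') summable_on \<Gamma>"
proof -
  obtain B where B: "0 \<le> B" "cp_norm \<Gamma> \<Lambda> f = ennreal B"
    using norm by (cases "cp_norm \<Gamma> \<Lambda> f") auto
  have "l2_norm \<Gamma> (cp_matrix \<xi> f \<gamma>) \<le> ennreal B"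
    unfolding l2_norm_le_iff[OF B(1)] using L2_set_row_le[OF _ B(1) \<xi> \<gamma>] B(2) by simp
  then have "(\<lambda>\<gamma>'. (cmod (cp_matrix \<xi> f \<gamma> \<gamma>'))\<^sup>2) summable_on \<Gamma>"
    by (auto simp: l2_norm_def top_unique split: if_splits)
  moreover have "(\<lambda>\<gamma>'. (cmod (c \<gamma>'))\<^sup>2) summable_on \<Gamma>"
    using c by (simp add: l2_def)
  ultimately have "(\<lambda>\<gamma>'. norm (cp_matrix \<xi> f \<gamma> \<gamma>' * c \<gamma>')) summable_on \<Gamma>"
    using abs_summable_product[of "cp_matrix \<xi> f \<gamma>" \<Gamma> c] by (simp add: norm_mult power2_eq_square)
  then show ?thesis
    by (rule abs_summable_summable)
qed

text \<open>If a norm on the right is infinite there is nothing to show. Otherwise all rows are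
  summable against l2 vectors, so \<open>cp_rep\<close> is additive in f, and Minkowski on finite
  sets finishes.\<close>

lemma cp_norm_add_le: "cp_norm \<Gamma> \<Lambda> (cp_add f f') \<le> cp_norm \<Gamma> \<Lambda> f + cp_norm \<Gamma> \<Lambda> f'"
proof (cases "cp_norm \<Gamma> \<Lambda> f < \<infinity> \<and> cp_norm \<Gamma> \<Lambda> f' < \<infinity>")
  case False
  then show ?thesis
    by (auto simp: less_top[symmetric])
next
  case True
  obtain B where B: "0 \<le> B" "cp_norm \<Gamma> \<Lambda> f = ennreal B"
    using True by (cases "cp_norm \<Gamma> \<Lambda> f") auto
  obtain B' where B': "0 \<le> B'" "cp_norm \<Gamma> \<Lambda> f' = ennreal B'"
    using True by (cases "cp_norm \<Gamma> \<Lambda> f'") auto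
  have "l2_norm \<Gamma> (cp_rep \<Gamma> \<xi> (cp_add f f') c) \<le> ennreal (B + B')"
    if \<xi>: "\<xi> \<in> \<Lambda>" and c: "c \<in> l2 \<Gamma>" "l2_norm \<Gamma> c \<le> 1" for \<xi> c
  proof -
    have add: "cp_rep \<Gamma> \<xi> (cp_add f f') c \<gamma> = cp_rep \<Gamma> \<xi> f c \<gamma> + cp_rep \<Gamma> \<xi> f' c \<gamma>"
      if "\<gamma> \<in> \<Gamma>" for \<gamma>
    proof -
      have "cp_matrix \<xi> (cp_add f f') \<gamma> \<gamma>' * c \<gamma>'
          = cp_matrix \<xi> f \<gamma> \<gamma>' * c \<gamma>' + cp_matrix \<xi> f' \<gamma> \<gamma>' * c \<gamma>'" for \<gamma>'
        by (simp add: cp_matrix_def cp_add_def distrib_right)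
      then show ?thesis
        using True that
          infsum_add[OF row_times_l2_summable[OF _ \<xi> that c(1)] row_times_l2_summable[OF _ \<xi> that c(1)], of f f']
        by (simp add: cp_rep_eq)
    qed
    have "l2_norm \<Gamma> (cp_rep \<Gamma> \<xi> f c) \<le> ennreal B" "l2_norm \<Gamma> (cp_rep \<Gamma> \<xi> f' c) \<le> ennreal B'"
      using B(2) B'(2) \<xi> c cp_norm_le_iff by (metis order_refl)+
    then have le: "L2_set (\<lambda>\<gamma>. cmod (cp_rep \<Gamma> \<xi> f c \<gamma>)) F \<le> B"
        "L2_set (\<lambda>\<gamma>. cmod (cp_rep \<Gamma> \<xi> f' c \<gamma>)) F \<le> B'"
      if "finite F" "F \<subseteq> \<Gamma>" for F
      using that by (auto simp: l2_norm_le_iff B B')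
    have "L2_set (\<lambda>\<gamma>. cmod (cp_rep \<Gamma> \<xi> (cp_add f f') c \<gamma>)) F \<le> B + B'"
      if F: "finite F" "F \<subseteq> \<Gamma>" for F
    proof -
      have "L2_set (\<lambda>\<gamma>. cmod (cp_rep \<Gamma> \<xi> (cp_add f f') c \<gamma>)) F
          \<le> L2_set (\<lambda>\<gamma>. cmod (cp_rep \<Gamma> \<xi> f c \<gamma>) + cmod (cp_rep \<Gamma> \<xi> f' c \<gamma>)) F"
        by (rule L2_set_mono) (use F add in \<open>auto simp: subset_iff intro: norm_triangle_ineq\<close>)
      also have "\<dots> \<le> L2_set (\<lambda>\<gamma>. cmod (cp_rep \<Gamma> \<xi> f c \<gamma>)) F + L2_set (\<lambda>\<gamma>. cmod (cp_rep \<Gamma> \<xi> f' c \<gamma>)) F"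
        by (rule L2_set_triangle_ineq)
      also have "\<dots> \<le> B + B'"
        by (intro add_mono le F)
      finally show ?thesis .
    qed
    then show ?thesis
      using B B' by (simp add: l2_norm_le_iff del: ennreal_plus)
  qed
  then show ?thesis
    using B B' by (simp add: cp_norm_le_iff ennreal_plus[symmetric] del: ennreal_plus)
qed

lemma cp_norm_diff_commute: "cp_norm \<Gamma> \<Lambda> (cp_diff f f') = cp_norm \<Gamma> \<Lambda> (cp_diff f' f)"
proof -
  have "cp_rep \<Gamma> \<xi> (cp_diff f f') c = (\<lambda>\<gamma>. - cp_rep \<Gamma> \<xi> (cp_diff f' f) c \<gamma>)" for \<xi> c
  proof
    fix \<gamma>
    have "cp_matrix \<xi> (cp_diff f f') \<gamma> \<gamma>' * c \<gamma>' = - (cp_matrix \<xi> (cp_diff f' f) \<gamma> \<gamma>' * c \<gamma>')" for \<gamma>'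
      by (simp add: cp_matrix_def cp_diff_def algebra_simps)
    then show "cp_rep \<Gamma> \<xi> (cp_diff f f') c \<gamma> = - cp_rep \<Gamma> \<xi> (cp_diff f' f) c \<gamma>"
      by (simp add: cp_rep_eq infsum_uminus)
  qed
  then have "l2_norm \<Gamma> (cp_rep \<Gamma> \<xi> (cp_diff f f') c) = l2_norm \<Gamma> (cp_rep \<Gamma> \<xi> (cp_diff f' f) c)" for \<xi> c
    by (intro l2_norm_cong) simp
  then show ?thesis
    by (simp add: cp_norm_def op_norm_def)
qed

section \<open>Norm bounds for finite sums\<close>

text \<open>A formal sum carried by one g acts as a left translation of \<Gamma> followed by
  multiplication with values of modulus at most \<epsilon>. The bound is asked for at every \<xi>
  because the matrix evaluates \<open>f g\<close> at the moved points.\<close>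

lemma cp_norm_single_le:
  fixes \<epsilon> :: real
  assumes \<Gamma>: "subgroup \<Gamma> isom_plus" and g: "g \<in> \<Gamma>"
    and f: "\<And>h \<xi>. h \<noteq> g \<Longrightarrow> f h \<xi> = 0" and \<epsilon>: "0 \<le> \<epsilon>" "\<And>\<xi>. cmod (f g \<xi>) \<le> \<epsilon>"
  shows "cp_norm \<Gamma> \<Lambda> f \<le> ennreal \<epsilon>"
  unfolding cp_norm_le_iff l2_norm_le_iff[OF \<epsilon>(1)]
proof (intro ballI impI allI)
  interpret group isom_plus
    by (rule group_isom_plus)
  interpret subgroup \<Gamma> isom_plus
    by (rule \<Gamma>)
  fix \<xi> c F
  assume c: "c \<in> l2 \<Gamma>" "l2_norm \<Gamma> c \<le> 1" and "finite F \<and> F \<subseteq> \<Gamma>"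
  then have F: "finite F" "F \<subseteq> \<Gamma>"
    by auto
  let ?s = "\<lambda>\<gamma>. inv\<^bsub>isom_plus\<^esub> g \<otimes>\<^bsub>isom_plus\<^esub> \<gamma>"
  have entry: "cp_rep \<Gamma> \<xi> f c \<gamma> = f g (bdry (inv\<^bsub>isom_plus\<^esub> \<gamma>) \<xi>) * c (?s \<gamma>)" if \<gamma>: "\<gamma> \<in> \<Gamma>" for \<gamma>
  proof -
    \<comment> \<open>Each row has at most one nonzero entry, so its sum has a single term.\<close>
    have sol: "\<gamma> \<otimes>\<^bsub>isom_plus\<^esub> inv\<^bsub>isom_plus\<^esub> \<gamma>' = g \<longleftrightarrow> \<gamma>' = ?s \<gamma>" if "\<gamma>' \<in> \<Gamma>" for \<gamma>'
      using that \<gamma> g inv_solve_right[of g \<gamma> \<gamma>'] inv_solve_left[of \<gamma>' g \<gamma>] mem_carrier by auto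
    have s: "?s \<gamma> \<in> \<Gamma>"
      using \<gamma> g by simp
    have "cp_rep \<Gamma> \<xi> f c \<gamma> = (\<Sum>\<^sub>\<infinity>\<gamma>'\<in>\<Gamma>. cp_matrix \<xi> f \<gamma> \<gamma>' * c \<gamma>')"
      using \<gamma> by (simp add: cp_rep_eq)
    also have "\<dots> = (\<Sum>\<^sub>\<infinity>\<gamma>'\<in>{?s \<gamma>}. cp_matrix \<xi> f \<gamma> \<gamma>' * c \<gamma>')"
      by (rule infsum_cong_neutral) (use s sol f in \<open>auto simp: cp_matrix_def\<close>)
    also have "\<dots> = cp_matrix \<xi> f \<gamma> (?s \<gamma>) * c (?s \<gamma>)"
      by simp
    finally show ?thesis
      using sol[OF s] by (simp add: cp_matrix_def)
  qed
  have "L2_set (\<lambda>\<gamma>. cmod (cp_rep \<Gamma> \<xi> f c \<gamma>)) F \<le> L2_set (\<lambda>\<gamma>. \<epsilon> * cmod (c (?s \<gamma>))) F"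
    by (rule L2_set_mono)
      (use F \<epsilon> entry in \<open>auto simp: norm_mult subset_iff intro!: mult_right_mono\<close>)
  also have "\<dots> = \<epsilon> * L2_set (\<lambda>\<gamma>. cmod (c (?s \<gamma>))) F"
    by (rule L2_set_right_distrib[symmetric, OF \<epsilon>(1)])
  also have "L2_set (\<lambda>\<gamma>. cmod (c (?s \<gamma>))) F = L2_set (\<lambda>\<gamma>. cmod (c \<gamma>)) (?s ` F)"
  proof -
    have "inj_on ?s F"
      using F g by (intro inj_onI) (auto simp: subset_iff)
    then show ?thesis
      by (simp add: L2_set_def sum.reindex)
  qed
  also have "\<epsilon> * L2_set (\<lambda>\<gamma>. cmod (c \<gamma>)) (?s ` F) \<le> \<epsilon> * 1"
  proof (rule mult_left_mono[OF _ \<epsilon>(1)])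
    have "finite (?s ` F)" "?s ` F \<subseteq> \<Gamma>"
      using F g by auto
    then show "L2_set (\<lambda>\<gamma>. cmod (c \<gamma>)) (?s ` F) \<le> 1"
      using c(2) l2_norm_le_iff[of 1 \<Gamma> c] by simp
  qed
  finally show "L2_set (\<lambda>\<gamma>. cmod (cp_rep \<Gamma> \<xi> f c \<gamma>)) F \<le> \<epsilon>"
    by simp
qed

text \<open>Triangle inequality, one group element at a time. The crude factor \<open>card S\<close>
  suffices, as only finite sums with fixed support and small coefficients are estimated with
  it.\<close>

lemma cp_norm_finite_support_le:
  fixes \<epsilon> :: real
  assumes \<Gamma>: "subgroup \<Gamma> isom_plus" and S: "finite S" "S \<subseteq> \<Gamma>"
    and f: "\<And>h \<xi>. h \<notin> S \<Longrightarrow> f h \<xi> = 0" and \<epsilon>: "0 \<le> \<epsilon>" "\<And>h \<xi>. cmod (f h \<xi>) \<le> \<epsilon>"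
  shows "cp_norm \<Gamma> \<Lambda> f \<le> ennreal (card S * \<epsilon>)"
  using S f \<epsilon>(2)
proof (induction S arbitrary: f rule: finite_induct)
  case empty
  then have "f = (\<lambda>h \<xi>. 0)"
    by auto
  then have "cp_rep \<Gamma> \<xi> f c = (\<lambda>\<gamma>. 0)" for \<xi> c
    by (auto simp: cp_rep_def)
  then have "cp_norm \<Gamma> \<Lambda> f \<le> 0"
    unfolding cp_norm_le_iff by (simp add: l2_norm_def)
  then show ?case
    by simp
next
  case (insert g S)
  define f1 where "f1 h \<xi> = (if h = g then f h \<xi> else 0)" for h \<xi>
  define f2 where "f2 h \<xi> = (if h = g then 0 else f h \<xi>)" for h \<xi>
  have "f = cp_add f1 f2"
    by (auto simp: cp_add_def f1_def f2_def fun_eq_iff)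
  then have "cp_norm \<Gamma> \<Lambda> f \<le> cp_norm \<Gamma> \<Lambda> f1 + cp_norm \<Gamma> \<Lambda> f2"
    by (simp add: cp_norm_add_le)
  also have "\<dots> \<le> ennreal \<epsilon> + ennreal (card S * \<epsilon>)"
  proof (rule add_mono)
    show "cp_norm \<Gamma> \<Lambda> f1 \<le> ennreal \<epsilon>"
      by (rule cp_norm_single_le[OF \<Gamma>, of g]) (use insert \<epsilon> in \<open>auto simp: f1_def\<close>)
    show "cp_norm \<Gamma> \<Lambda> f2 \<le> ennreal (card S * \<epsilon>)"
      by (rule insert.IH) (use insert \<epsilon> in \<open>auto simp: f2_def\<close>)
  qed
  also have "\<dots> = ennreal (card (insert g S) * \<epsilon>)"
    using insert.hyps \<epsilon>(1) by (simp add: ennreal_plus[symmetric] distrib_right del: ennreal_plus)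
  finally show ?case .
qed

section \<open>The flow\<close>

text \<open>For x = 0 this is the logarithm of the conformal derivative of g at \<xi>, and the
  cocycle identity is then the chain rule.\<close>

definition cocycle :: "('m::finite) point \<Rightarrow> 'm isom \<Rightarrow> 'm point \<Rightarrow> real" where
  "cocycle x g \<xi> = busemann x ((inv\<^bsub>isom_plus\<^esub> g) x) \<xi>"

lemma flow_eq: "flow x t f g \<xi> = exp (\<i> * of_real (t * cocycle x g \<xi>)) * f g \<xi>"
  by (simp add: flow_def cocycle_def)

lemma isom_plus_inv_apply:
  assumes "g \<in> carrier isom_plus" "y \<in> hyp_space"
  shows "g ((inv\<^bsub>isom_plus\<^esub> g) y) = y"
proof -
  interpret group isom_plus
    by (rule group_isom_plus)
  show ?thesis
    using assms isom_plus_mult[of y "inv\<^bsub>isom_plus\<^esub> g" g] by (simp add: isom_plus_one)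
qed

lemma isom_plus_apply_mem: "g \<in> carrier isom_plus \<Longrightarrow> y \<in> hyp_space \<Longrightarrow> g y \<in> hyp_space"
  by (simp only: carrier_isom_plus hyp_isometry_mem)

text \<open>For the right action (gh)^{-1} takes x to x h^{-1} g^{-1}. Pass through x g^{-1}: the
  first leg is the cocycle of g, and the second, moved by g, runs from x to x h^{-1} as seen from
  \<xi> g.\<close>

lemma cocycle_mult:
  assumes x: "x \<in> hyp_space" and g: "g \<in> carrier isom_plus" and h: "h \<in> carrier isom_plus"
    and \<xi>: "\<xi> \<in> sphere_at_infinity"
  shows "cocycle x (g \<otimes>\<^bsub>isom_plus\<^esub> h) \<xi> = cocycle x g \<xi> + cocycle x h (bdry g \<xi>)"
proof -
  interpret group isom_plus
    by (rule group_isom_plus)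
  let ?g = "inv\<^bsub>isom_plus\<^esub> g" and ?h = "inv\<^bsub>isom_plus\<^esub> h"
  have mem: "?g x \<in> hyp_space" "?h x \<in> hyp_space" "?g (?h x) \<in> hyp_space"
    using g h x isom_plus_apply_mem inv_closed by blast+
  have "cocycle x (g \<otimes>\<^bsub>isom_plus\<^esub> h) \<xi> = busemann x (?g (?h x)) \<xi>"
    using g h by (simp add: cocycle_def inv_mult_group isom_plus_mult[OF x])
  also have "\<dots> = busemann x (?g x) \<xi> + busemann (?g x) (?g (?h x)) \<xi>"
    by (rule busemann_cocycle[OF x mem(1,3) \<xi>])
  also have "busemann (?g x) (?g (?h x)) \<xi> = busemann (g (?g x)) (g (?g (?h x))) (bdry g \<xi>)"
    using busemann_bdry[OF _ mem(1,3) \<xi>, of g] g by (simp add: carrier_isom_plus)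
  also have "\<dots> = busemann x (?h x) (bdry g \<xi>)"
    using isom_plus_inv_apply[OF g x] isom_plus_inv_apply[OF g mem(2)] by simp
  finally show ?thesis
    by (simp add: cocycle_def)
qed

lemma cocycle_one:
  assumes "x \<in> hyp_space" "\<xi> \<in> sphere_at_infinity"
  shows "cocycle x \<one>\<^bsub>isom_plus\<^esub> \<xi> = 0"
proof -
  interpret group isom_plus
    by (rule group_isom_plus)
  show ?thesis
    using busemann_cocycle[OF assms(1,1,1,2)] assms by (simp add: cocycle_def isom_plus_one)
qed

lemma cocycle_inv:
  assumes x: "x \<in> hyp_space" and g: "g \<in> carrier isom_plus" and \<xi>: "\<xi> \<in> sphere_at_infinity"
  shows "cocycle x (inv\<^bsub>isom_plus\<^esub> g) (bdry g \<xi>) = - cocycle x g \<xi>"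
proof -
  interpret group isom_plus
    by (rule group_isom_plus)
  show ?thesis
    using cocycle_mult[OF x g _ \<xi>, of "inv\<^bsub>isom_plus\<^esub> g"] cocycle_one[OF x \<xi>] g by simp
qed

text \<open>The cocycle identity for g^{-1} (g h^{-1}) = h^{-1}. It splits the phase of a matrix
  entry into a row factor and a column factor, the mark of conjugation by a diagonal matrix.\<close>

lemma cocycle_row:
  assumes x: "x \<in> hyp_space" and g: "g \<in> carrier isom_plus" and h: "h \<in> carrier isom_plus"
    and \<xi>: "\<xi> \<in> sphere_at_infinity"
  shows "cocycle x (g \<otimes>\<^bsub>isom_plus\<^esub> inv\<^bsub>isom_plus\<^esub> h) (bdry (inv\<^bsub>isom_plus\<^esub> g) \<xi>) =
    cocycle x (inv\<^bsub>isom_plus\<^esub> h) \<xi> - cocycle x (inv\<^bsub>isom_plus\<^esub> g) \<xi>"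
proof -
  interpret group isom_plus
    by (rule group_isom_plus)
  show ?thesis
    using cocycle_mult[OF x _ _ \<xi>, of "inv\<^bsub>isom_plus\<^esub> g" "g \<otimes>\<^bsub>isom_plus\<^esub> inv\<^bsub>isom_plus\<^esub> h"] g h
    by (simp add: m_assoc[symmetric])
qed

lemma continuous_on_cocycle:
  assumes x: "x \<in> hyp_space" and g: "g \<in> carrier isom_plus"
  shows "continuous_on sphere_at_infinity (cocycle x g)"
proof -
  interpret group isom_plus
    by (rule group_isom_plus)
  show ?thesis
    unfolding cocycle_def[abs_def]
    by (rule continuous_on_busemann[OF x isom_plus_apply_mem[OF _ x]]) (use g in simp)
qed

section \<open>Algebraic properties of the flow\<close>

lemma flow_zero: "flow x 0 f = f"
  by (simp add: flow_def fun_eq_iff)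

lemma flow_flow: "flow x (s + t) f = flow x s (flow x t f)"
  by (simp add: flow_def fun_eq_iff distrib_left distrib_right exp_add mult_ac)

lemma flow_add: "flow x t (cp_add f f') = cp_add (flow x t f) (flow x t f')"
  by (simp add: flow_def cp_add_def fun_eq_iff distrib_left)

lemma flow_diff: "flow x t (cp_diff f f') = cp_diff (flow x t f) (flow x t f')"
  by (simp add: flow_def cp_diff_def fun_eq_iff right_diff_distrib)

lemma flow_scale: "flow x t (cp_scale z f) = cp_scale z (flow x t f)"
  by (simp add: flow_def cp_scale_def fun_eq_iff)

text \<open>The phase at \<gamma> = g g' factors as the phase of g at \<xi> times that of g' at
  \<xi> g. It enters the \<open>infsum\<close> as a scalar, so the comparison is term by
  term.\<close>

lemma flow_mult:
  assumes x: "x \<in> hyp_space" and \<Gamma>: "subgroup \<Gamma> isom_plus" and \<Lambda>: "\<Lambda> \<subseteq> sphere_at_infinity"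
    and f: "f \<in> formal_sums \<Gamma> \<Lambda>"
  shows "flow x t (cp_mult \<Gamma> f f') = cp_mult \<Gamma> (flow x t f) (flow x t f')"
proof (intro ext)
  fix \<gamma> \<xi>
  let ?I = "{(g, g'). g \<in> \<Gamma> \<and> g' \<in> \<Gamma> \<and> g \<otimes>\<^bsub>isom_plus\<^esub> g' = \<gamma>}"
  let ?e = "\<lambda>g \<xi>. exp (\<i> * of_real (t * cocycle x g \<xi>))"
  have "?e \<gamma> \<xi> * (f g \<xi> * f' g' (bdry g \<xi>)) = flow x t f g \<xi> * flow x t f' g' (bdry g \<xi>)"
    if "(g, g') \<in> ?I" for g g'
  proof (cases "\<xi> \<in> \<Lambda>")
    case True
    then have "cocycle x \<gamma> \<xi> = cocycle x g \<xi> + cocycle x g' (bdry g \<xi>)"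
      using that \<Lambda> x cocycle_mult[of x g g' \<xi>] subgroup.mem_carrier[OF \<Gamma>] by auto
    then show ?thesis
      by (simp add: flow_eq distrib_left exp_add)
  next
    \<comment> \<open>The cocycle identity is available only on the sphere; off \<Lambda> both sides
      vanish through \<open>f g \<xi>\<close>.\<close>
    case False
    then show ?thesis
      using f by (simp add: formal_sums_def flow_def)
  qed
  then show "flow x t (cp_mult \<Gamma> f f') \<gamma> \<xi> = cp_mult \<Gamma> (flow x t f) (flow x t f') \<gamma> \<xi>"
    \<comment> \<open>The pattern unfolds \<open>flow\<close> only on the whole product, leaving it
      folded on the two factors as in the termwise identity.\<close>
    unfolding cp_mult_def flow_eq[of x t "\<lambda>\<gamma> \<xi>. infsum (F \<gamma> \<xi>) (I \<gamma> \<xi>)" for F I]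
      infsum_cmult_right'[symmetric]
    by (intro infsum_cong) auto
qed

text \<open>The involution conjugates the phase at (g^{-1}, \<xi> g), where the cocycle has the
  opposite sign; the two sign changes cancel.\<close>

lemma flow_star:
  assumes x: "x \<in> hyp_space" and \<Gamma>: "subgroup \<Gamma> isom_plus" and \<Lambda>: "\<Lambda> \<subseteq> sphere_at_infinity"
  shows "flow x t (cp_star \<Gamma> \<Lambda> f) = cp_star \<Gamma> \<Lambda> (flow x t f)"
proof (intro ext)
  fix g \<xi>
  show "flow x t (cp_star \<Gamma> \<Lambda> f) g \<xi> = cp_star \<Gamma> \<Lambda> (flow x t f) g \<xi>"
  proof (cases "g \<in> \<Gamma> \<and> \<xi> \<in> \<Lambda>")
    case True
    then have "cocycle x (inv\<^bsub>isom_plus\<^esub> g) (bdry g \<xi>) = - cocycle x g \<xi>"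
      using \<Lambda> x cocycle_inv[of x g \<xi>] subgroup.mem_carrier[OF \<Gamma>] by blast
    then show ?thesis
      using True by (simp add: cp_star_def flow_eq exp_cnj)
  next
    case False
    then show ?thesis
      by (auto simp: cp_star_def flow_eq)
  qed
qed

text \<open>
  The diagonal unitary that conjugates \<open>\<pi>\<^sup>\<xi>(\<alpha>\<^sub>t f)\<close> to \<open>\<pi>\<^sup>\<xi>(f)\<close> has entries \<open>exp (i t D(x, x\<gamma>, \<xi>))\<close>.
\<close>
lemma cp_norm_flow_le:
  assumes x: "x \<in> hyp_space" and \<Gamma>: "subgroup \<Gamma> isom_plus" and \<Lambda>: "\<Lambda> \<subseteq> sphere_at_infinity"
  shows "cp_norm \<Gamma> \<Lambda> (flow x t f) \<le> cp_norm \<Gamma> \<Lambda> f"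
  unfolding cp_norm_le_iff
proof (intro ballI impI)
  fix \<xi> c
  assume \<xi>: "\<xi> \<in> \<Lambda>" and c: "c \<in> l2 \<Gamma>" "l2_norm \<Gamma> c \<le> 1"
  define u where "u \<gamma> = exp (\<i> * of_real (t * cocycle x (inv\<^bsub>isom_plus\<^esub> \<gamma>) \<xi>))" for \<gamma>
  define c' where "c' \<gamma> = u \<gamma> * c \<gamma>" for \<gamma>
  have cmod_c': "cmod (c' \<gamma>) = cmod (c \<gamma>)" for \<gamma>
    by (simp add: c'_def u_def norm_mult)
  then have "l2_norm \<Gamma> c' = l2_norm \<Gamma> c"
    by (intro l2_norm_cong)
  moreover have "c' \<in> l2 \<Gamma>"
    using c(1) by (simp add: l2_def cmod_c') (simp add: c'_def)
  ultimately have "l2_norm \<Gamma> (cp_rep \<Gamma> \<xi> f c') \<le> cp_norm \<Gamma> \<Lambda> f"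
    using c(2) \<xi> cp_norm_le_iff[of \<Gamma> \<Lambda> f "cp_norm \<Gamma> \<Lambda> f"] by auto
  \<comment> \<open>The column factor of the phase is absorbed into c'; the row factor does not
    depend on the summation index and leaves the \<open>infsum\<close>.\<close>
  moreover have "cp_rep \<Gamma> \<xi> (flow x t f) c \<gamma> = inverse (u \<gamma>) * cp_rep \<Gamma> \<xi> f c' \<gamma>" if \<gamma>: "\<gamma> \<in> \<Gamma>" for \<gamma>
  proof -
    have "cp_matrix \<xi> (flow x t f) \<gamma> \<gamma>' * c \<gamma>' = inverse (u \<gamma>) * (cp_matrix \<xi> f \<gamma> \<gamma>' * c' \<gamma>')"
      if "\<gamma>' \<in> \<Gamma>" for \<gamma>'
    proof -
      have row: "cocycle x (\<gamma> \<otimes>\<^bsub>isom_plus\<^esub> inv\<^bsub>isom_plus\<^esub> \<gamma>') (bdry (inv\<^bsub>isom_plus\<^esub> \<gamma>) \<xi>) =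
          cocycle x (inv\<^bsub>isom_plus\<^esub> \<gamma>') \<xi> - cocycle x (inv\<^bsub>isom_plus\<^esub> \<gamma>) \<xi>"
        using that \<gamma> \<xi> \<Lambda> x cocycle_row[of x \<gamma> \<gamma>' \<xi>] subgroup.mem_carrier[OF \<Gamma>] by blast
      have "exp (\<i> * of_real (t * cocycle x (\<gamma> \<otimes>\<^bsub>isom_plus\<^esub> inv\<^bsub>isom_plus\<^esub> \<gamma>') (bdry (inv\<^bsub>isom_plus\<^esub> \<gamma>) \<xi>)))
          = inverse (u \<gamma>) * u \<gamma>'"
        unfolding row u_def by (simp add: right_diff_distrib exp_diff divide_inverse mult_ac)
      then show ?thesis
        by (simp add: cp_matrix_def flow_eq c'_def)
    qed
    then show ?thesis
      using \<gamma> by (simp add: cp_rep_eq infsum_cmult_right'[symmetric] cong: infsum_cong)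
  qed
  then have "l2_norm \<Gamma> (cp_rep \<Gamma> \<xi> (flow x t f) c) = l2_norm \<Gamma> (cp_rep \<Gamma> \<xi> f c')"
    by (intro l2_norm_cong) (simp add: norm_mult norm_inverse u_def)
  ultimately show "l2_norm \<Gamma> (cp_rep \<Gamma> \<xi> (flow x t f) c) \<le> cp_norm \<Gamma> \<Lambda> f"
    by simp
qed

section \<open>The flow on the completion\<close>

lemma flow_formal_sums:
  assumes x: "x \<in> hyp_space" and \<Gamma>: "subgroup \<Gamma> isom_plus" and \<Lambda>: "\<Lambda> \<subseteq> sphere_at_infinity"
    and f: "f \<in> formal_sums \<Gamma> \<Lambda>"
  shows "flow x t f \<in> formal_sums \<Gamma> \<Lambda>"
proof -
  have "continuous_on \<Lambda> (flow x t f g)" if g: "g \<in> \<Gamma>" for g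
    unfolding flow_eq[abs_def]
    by (intro continuous_intros continuous_on_subset[OF continuous_on_cocycle[OF x] \<Lambda>])
      (use f g subgroup.mem_carrier[OF \<Gamma>] in \<open>auto simp: formal_sums_def\<close>)
  then show ?thesis
    using f by (auto simp: formal_sums_def flow_def)
qed

text \<open>The flow keeps supports, since phases never vanish, and does not increase norms. So it
  carries finite approximants of f to finite approximants of its image.\<close>

lemma flow_reduced_cross_product:
  assumes x: "x \<in> hyp_space" and \<Gamma>: "subgroup \<Gamma> isom_plus" and \<Lambda>: "\<Lambda> \<subseteq> sphere_at_infinity"
    and f: "f \<in> reduced_cross_product \<Gamma> \<Lambda>"
  shows "flow x t f \<in> reduced_cross_product \<Gamma> \<Lambda>"
proof -
  have "\<exists>f'\<in>alg_cross_product \<Gamma> \<Lambda>. cp_norm \<Gamma> \<Lambda> (cp_diff (flow x t f) f') < \<epsilon>" if "\<epsilon> > 0" for \<epsilon>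
  proof -
    obtain f' where f': "f' \<in> alg_cross_product \<Gamma> \<Lambda>" "cp_norm \<Gamma> \<Lambda> (cp_diff f f') < \<epsilon>"
      using f \<open>\<epsilon> > 0\<close> unfolding reduced_cross_product_def by blast
    then have "cp_norm \<Gamma> \<Lambda> (cp_diff (flow x t f) (flow x t f')) < \<epsilon>"
      using cp_norm_flow_le[OF x \<Gamma> \<Lambda>] unfolding flow_diff[symmetric] by (metis order_le_less_trans)
    moreover have "flow x t f' \<in> alg_cross_product \<Gamma> \<Lambda>"
      using f'(1) flow_formal_sums[OF x \<Gamma> \<Lambda>] unfolding alg_cross_product_def by (simp add: flow_def)
    ultimately show ?thesis
      by blast
  qed
  then show ?thesis
    using f flow_formal_sums[OF x \<Gamma> \<Lambda>] unfolding reduced_cross_product_def by blast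
qed

lemma star_automorphism_flow:
  assumes x: "x \<in> hyp_space" and \<Gamma>: "subgroup \<Gamma> isom_plus" and \<Lambda>: "\<Lambda> \<subseteq> sphere_at_infinity"
  shows "star_automorphism \<Gamma> \<Lambda> (flow x t)"
proof -
  let ?A = "reduced_cross_product \<Gamma> \<Lambda>"
  have "flow x t (flow x (- t) f) = f" "flow x (- t) (flow x t f) = f" for f
    by (simp_all add: flow_flow[symmetric] flow_zero)
  then have "bij_betw (flow x t) ?A ?A"
    by (intro bij_betwI[where g = "flow x (- t)"])
      (simp_all add: flow_reduced_cross_product[OF x \<Gamma> \<Lambda>])
  then show ?thesis
    by (simp add: star_automorphism_def flow_add flow_scale flow_star[OF x \<Gamma> \<Lambda>]
        flow_mult[OF x \<Gamma> \<Lambda>] reduced_cross_product_def)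
qed

section \<open>Strong continuity\<close>

text \<open>A chord of the unit circle is no longer than its arc.\<close>

lemma cmod_exp_i_diff_le: "cmod (exp (\<i> * of_real s) - exp (\<i> * of_real t)) \<le> \<bar>s - t\<bar>"
proof -
  have "exp (\<i> * of_real s) - exp (\<i> * of_real t)
      = exp (\<i> * of_real t) * (exp (\<i> * of_real (s - t)) - 1)"
    by (simp add: algebra_simps exp_add[symmetric])
  then have "cmod (exp (\<i> * of_real s) - exp (\<i> * of_real t)) = 2 * \<bar>sin ((s - t) / 2)\<bar>"
    using dist_exp_i_1[of "s - t"] by (simp add: norm_mult)
  also have "\<dots> \<le> \<bar>s - t\<bar>"
    using abs_sin_x_le_abs_x[of "(s - t) / 2"] by simp
  finally show ?thesis .
qed

lemma alg_cross_product_flow_lipschitz: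
  assumes x: "x \<in> hyp_space" and \<Gamma>: "subgroup \<Gamma> isom_plus"
    and \<Lambda>: "\<Lambda> \<subseteq> sphere_at_infinity" "closed \<Lambda>" and f: "f \<in> alg_cross_product \<Gamma> \<Lambda>"
  obtains C where "C \<ge> 0"
    "\<And>s t. cp_norm \<Gamma> \<Lambda> (cp_diff (flow x s f) (flow x t f)) \<le> ennreal (C * \<bar>s - t\<bar>)"
proof -
  define S where "S = {g \<in> \<Gamma>. \<exists>\<xi>\<in>\<Lambda>. f g \<xi> \<noteq> 0}"
  have S: "finite S" "S \<subseteq> \<Gamma>"
    using f by (auto simp: S_def alg_cross_product_def)
  have outside: "f g \<xi> = 0" if "g \<notin> S \<or> \<xi> \<notin> \<Lambda>" for g \<xi>
    using f that by (auto simp: S_def alg_cross_product_def formal_sums_def)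
  have "compact \<Lambda>"
    using \<Lambda> by (metis bounded_sphere bounded_subset compact_eq_bounded_closed)
  have "\<exists>M. \<forall>\<xi>\<in>\<Lambda>. cmod (of_real (cocycle x g \<xi>) * f g \<xi>) \<le> M" if "g \<in> S" for g
  proof -
    have "g \<in> \<Gamma>"
      using that S by blast
    then have "continuous_on \<Lambda> (\<lambda>\<xi>. of_real (cocycle x g \<xi>) * f g \<xi>)"
      using f subgroup.mem_carrier[OF \<Gamma>]
      by (intro continuous_intros continuous_on_subset[OF continuous_on_cocycle[OF x] \<Lambda>(1)])
        (auto simp: alg_cross_product_def formal_sums_def)
    then have "bounded ((\<lambda>\<xi>. of_real (cocycle x g \<xi>) * f g \<xi>) ` \<Lambda>)"
      using \<open>compact \<Lambda>\<close> by (intro compact_imp_bounded compact_continuous_image)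
    then show ?thesis
      by (auto simp: bounded_iff)
  qed
  then obtain M where M: "\<And>g \<xi>. g \<in> S \<Longrightarrow> \<xi> \<in> \<Lambda> \<Longrightarrow> cmod (of_real (cocycle x g \<xi>) * f g \<xi>) \<le> M g"
    by metis
  \<comment> \<open>A sum of absolute values bounds all coefficients at once and, unlike a maximum,
    also covers empty \<open>S\<close>.\<close>
  define K where "K = (\<Sum>g\<in>S. \<bar>M g\<bar>)"
  have K: "K \<ge> 0"
    by (simp add: K_def sum_nonneg)
  have bound: "cmod (cp_diff (flow x s f) (flow x t f) g \<xi>) \<le> \<bar>s - t\<bar> * K" for s t g \<xi>
  proof (cases "g \<in> S \<and> \<xi> \<in> \<Lambda>")
    case True
    have "cp_diff (flow x s f) (flow x t f) g \<xi> =
        (exp (\<i> * of_real (s * cocycle x g \<xi>)) - exp (\<i> * of_real (t * cocycle x g \<xi>))) * f g \<xi>"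
      by (simp add: cp_diff_def flow_eq left_diff_distrib)
    then have "cmod (cp_diff (flow x s f) (flow x t f) g \<xi>)
        \<le> \<bar>s * cocycle x g \<xi> - t * cocycle x g \<xi>\<bar> * cmod (f g \<xi>)"
      by (simp only: norm_mult mult_right_mono[OF cmod_exp_i_diff_le] norm_ge_zero)
    also have "\<dots> = \<bar>s - t\<bar> * cmod (of_real (cocycle x g \<xi>) * f g \<xi>)"
      by (simp add: left_diff_distrib[symmetric] abs_mult norm_mult)
    also have "\<dots> \<le> \<bar>s - t\<bar> * K"
    proof (rule mult_left_mono)
      have "cmod (of_real (cocycle x g \<xi>) * f g \<xi>) \<le> \<bar>M g\<bar>"
        using M True by (meson abs_ge_self order_trans)
      also have "\<dots> \<le> K"
        unfolding K_def by (rule member_le_sum) (use True S in auto)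
      finally show "cmod (of_real (cocycle x g \<xi>) * f g \<xi>) \<le> K" .
    qed simp
    finally show ?thesis .
  next
    case False
    then show ?thesis
      using outside[of g \<xi>] K by (auto simp: cp_diff_def flow_def)
  qed
  show ?thesis
  proof
    show "0 \<le> card S * K"
      using K by simp
    fix s t
    have "cp_norm \<Gamma> \<Lambda> (cp_diff (flow x s f) (flow x t f)) \<le> ennreal (card S * (\<bar>s - t\<bar> * K))"
      by (rule cp_norm_finite_support_le[OF \<Gamma> S _ _ bound])
        (use K outside in \<open>auto simp: cp_diff_def flow_def\<close>)
    then show "cp_norm \<Gamma> \<Lambda> (cp_diff (flow x s f) (flow x t f)) \<le> ennreal (card S * K * \<bar>s - t\<bar>)"
      by (simp add: mult_ac)
  qed
qed

text \<open>Three-term splitting through a finite approximant f': the two outer terms are small for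
  all times because the flow does not increase norms, the middle one by the Lipschitz bound.\<close>

lemma flow_strongly_continuous:
  assumes x: "x \<in> hyp_space" and \<Gamma>: "subgroup \<Gamma> isom_plus"
    and \<Lambda>: "\<Lambda> \<subseteq> sphere_at_infinity" "closed \<Lambda>" and f: "f \<in> reduced_cross_product \<Gamma> \<Lambda>"
  shows "((\<lambda>t. cp_norm \<Gamma> \<Lambda> (cp_diff (flow x t f) (flow x s f))) \<longlongrightarrow> 0) (at s)"
proof (rule order_tendstoI)
  let ?N = "cp_norm \<Gamma> \<Lambda>"
  fix e :: ennreal
  assume "0 < e"
  \<comment> \<open>\<open>e\<close> may be infinite, so a real number below it takes its
    place.\<close>
  then obtain r where r: "0 < r" "ennreal r < e"
    by (metis ennreal_0 ennreal_less_zero_iff dense ennreal_cases less_top order_less_trans not_less_iff_gr_or_eq)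
  obtain f' where f': "f' \<in> alg_cross_product \<Gamma> \<Lambda>" "?N (cp_diff f f') < ennreal (r / 3)"
    using f r(1) unfolding reduced_cross_product_def by force
  obtain C where C: "C \<ge> 0"
    "\<And>s t. ?N (cp_diff (flow x s f') (flow x t f')) \<le> ennreal (C * \<bar>s - t\<bar>)"
    using alg_cross_product_flow_lipschitz[OF x \<Gamma> \<Lambda> f'(1)] by metis
  have "((\<lambda>t. C * \<bar>t - s\<bar>) \<longlongrightarrow> C * \<bar>s - s\<bar>) (at s)"
    by (intro tendsto_intros)
  then have "\<forall>\<^sub>F t in at s. C * \<bar>t - s\<bar> < r / 3"
    by (rule order_tendstoD) (use r in simp)
  then show "\<forall>\<^sub>F t in at s. ?N (cp_diff (flow x t f) (flow x s f)) < e"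
  proof eventually_elim
    case (elim t)
    have "cp_diff (flow x t f) (flow x s f) = cp_add (flow x t (cp_diff f f'))
        (cp_add (cp_diff (flow x t f') (flow x s f')) (flow x s (cp_diff f' f)))"
      by (simp add: flow_diff) (simp add: cp_add_def cp_diff_def fun_eq_iff)
    then have "?N (cp_diff (flow x t f) (flow x s f)) \<le> ?N (flow x t (cp_diff f f'))
        + (?N (cp_diff (flow x t f') (flow x s f')) + ?N (flow x s (cp_diff f' f)))"
      by (simp only: order_trans[OF cp_norm_add_le add_left_mono[OF cp_norm_add_le]])
    also have "\<dots> \<le> ennreal (r / 3) + (ennreal (r / 3) + ennreal (r / 3))"
    proof (intro add_mono)
      show "?N (flow x t (cp_diff f f')) \<le> ennreal (r / 3)"
        using cp_norm_flow_le[OF x \<Gamma> \<Lambda>(1)] f'(2) by (metis order.strict_implies_order order_trans)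
      show "?N (flow x s (cp_diff f' f)) \<le> ennreal (r / 3)"
        using cp_norm_flow_le[OF x \<Gamma> \<Lambda>(1)] f'(2) cp_norm_diff_commute
        by (metis order.strict_implies_order order_trans)
      show "?N (cp_diff (flow x t f') (flow x s f')) \<le> ennreal (r / 3)"
        using C(2)[of t s] elim by (meson ennreal_leI less_imp_le order_trans)
    qed
    also have "\<dots> = ennreal r"
      using r(1) by (simp add: ennreal_plus[symmetric] del: ennreal_plus)
    finally show ?case
      using r(2) by (rule order_le_less_trans)
  qed
\<comment> \<open>What remains is the lower half of the order criterion, which is vacuous: no
  \<open>ennreal\<close> lies below 0.\<close>
qed simp

lemma limit_set_subset_sphere: "limit_set \<Gamma> \<subseteq> sphere_at_infinity"
  by (auto simp: limit_set_def)

text \<open>An intersection of closed sets. Inside the sphere this gives compactness, which bounds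
  the cocycle against continuous coefficients.\<close>

lemma closed_limit_set: "closed (limit_set \<Gamma>)"
proof -
  have "limit_set \<Gamma> = sphere_at_infinity \<inter>
      \<Inter>{A. A \<subseteq> sphere_at_infinity \<and> A \<noteq> {} \<and> closed A \<and> (\<forall>g\<in>\<Gamma>. bdry g ` A \<subseteq> A)}"
    by (auto simp: limit_set_def)
  moreover have "closed \<dots>"
    by (intro closed_Int closed_Inter) auto
  ultimately show ?thesis
    by simp
qed

theorem proposition4p2:
  fixes \<Gamma> :: "('m::finite) isom set" and x :: "'m point"
  assumes "discrete_subgroup \<Gamma>"
    and "torsion_free \<Gamma>"
    and "nonelementary \<Gamma>"
    and "x \<in> hyp_space"
  shows "strongly_continuous_automorphism_group \<Gamma> (limit_set \<Gamma>) (flow x)"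
proof -
  have \<Gamma>: "subgroup \<Gamma> isom_plus"
    using assms(1) by (simp add: discrete_subgroup_def)
  note \<Lambda> = limit_set_subset_sphere[of \<Gamma>] closed_limit_set[of \<Gamma>]
  show ?thesis
    unfolding strongly_continuous_automorphism_group_def
    using star_automorphism_flow[OF assms(4) \<Gamma> \<Lambda>(1)]
      flow_strongly_continuous[OF assms(4) \<Gamma> \<Lambda>]
    by (simp add: flow_zero flow_flow)
qed

end
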